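(* Let $\theta\in H^\infty$ be inner, let $\phi,\psi\in L^\infty$ be unimodular with $\phi K_\theta\perp\psi K_\theta$ and such that neither $\phi\overline\psi$ nor $\overline\phi\psi$ is a constant multiple of $\theta$, let $M=\phi K_\theta\oplus\psi K_\theta$, let $g\in L^\infty$, and let $$\mathcal G=\begin{pmatrix}\overline\theta&0&0&0\\0&\overline\theta&0&0\\ g&g\overline\phi\psi&\theta&0\\ g\phi\overline\psi&g&0&\theta\end{pmatrix}.$$ Then $T^M_g$ is invertible (on $M$) if and only if $T_{\mathcal G}$ is invertible (on $(H^2)^4$), and in that case, for all $h_M\in M$, $$(T^M_g)^{-1}h_M=\phi\,P_1T_{\mathcal G}^{-1}U_0h_M+\psi\,P_2T_{\mathcal G}^{-1}U_0h_M,$$ where $P_j(x_1,x_2,x_3,x_4)=x_j$ and $U_0:M\to(H^2)^4$ is given by $U_0h_M=(0,0,P_\theta\overline\phi h_M,P_\theta\overline\psi h_M)$.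
   Context: All function spaces are on the unit circle $\mathbb T$; $H^2,H^\infty$ are the Hardy spaces of the unit disc. For $\theta$ inner, $K_\theta=H^2\ominus\theta H^2$; $P_\theta$ and $P^+$ are the orthogonal projections from $L^2=L^2(\mathbb T)$ onto $K_\theta$ and onto $H^2$ respectively. $M=\phi K_\theta\oplus\psi K_\theta$ (orthogonal sum) is a closed subspace of $L^2$ with orthogonal projection $P_M$, and $T^M_gf=P_M(gf)$ for $f\in M$. $T_{\mathcal G}f=P^+(\mathcal Gf)$ on $(H^2)^4$ ($P^+$ applied componentwise). *)

theory Defs
  imports "HOL-Analysis.Analysis" "HOL-Library.Function_Algebras"
begin

section \<open>The unit circle and its Lebesgue spaces\<close>

text \<open>
  Normalised arc length on the unit circle, as a Borel measure on the complex plane that is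
  concentrated on the circle. Functions on the circle are functions \<open>complex \<Rightarrow> complex\<close>
  whose values off the circle are irrelevant.
\<close>

definition circle :: "complex measure" where
  "circle = distr (uniform_measure lborel {0..<2 * pi}) borel cis"

definition Linf :: "(complex \<Rightarrow> complex) set" where
  "Linf = {a \<in> borel_measurable circle. \<exists>C. AE z in circle. cmod (a z) \<le> C}"

definition unimodular :: "(complex \<Rightarrow> complex) \<Rightarrow> bool" where
  "unimodular a \<longleftrightarrow> (AE z in circle. cmod (a z) = 1)"

definition sq_integrable :: "(complex \<Rightarrow> complex) set" where
  "sq_integrable = {f \<in> borel_measurable circle. integrable circle (\<lambda>z. (cmod (f z))\<^sup>2)}"

definition l2_rel :: "(complex \<Rightarrow> complex) \<Rightarrow> (complex \<Rightarrow> complex) \<Rightarrow> bool" where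
  "l2_rel f g \<longleftrightarrow> f \<in> sq_integrable \<and> g \<in> sq_integrable \<and> (AE z in circle. f z = g z)"

lemma sets_circle [simp, measurable_cong]: "sets circle = sets borel"
  by (simp add: circle_def)

lemma space_circle [simp]: "space circle = UNIV"
  by (simp add: circle_def)

lemma sq_integrable_measurable: "f \<in> sq_integrable \<Longrightarrow> f \<in> borel_measurable circle"
  by (simp add: sq_integrable_def)

lemma borel_measurable_cnj [measurable]:
  "f \<in> borel_measurable N \<Longrightarrow> (\<lambda>x. cnj (f x)) \<in> borel_measurable N"
  by (rule borel_measurable_continuous_on[where f = cnj]) (auto intro: continuous_intros)

lemma integrable_sq_bound:
  assumes f: "f \<in> sq_integrable" and g: "g \<in> sq_integrable"
    and h: "h \<in> borel_measurable circle"
    and le: "\<And>z. norm (h z) \<le> c * ((cmod (f z))\<^sup>2 + (cmod (g z))\<^sup>2)"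
  shows "integrable circle (h :: complex \<Rightarrow> 'b::{banach, second_countable_topology})"
proof (rule Bochner_Integration.integrable_bound)
  show "integrable circle (\<lambda>z. c * ((cmod (f z))\<^sup>2 + (cmod (g z))\<^sup>2))"
    using f g by (auto simp: sq_integrable_def)
  show "AE z in circle. norm (h z) \<le> norm (c * ((cmod (f z))\<^sup>2 + (cmod (g z))\<^sup>2))"
    using le by (auto intro: order_trans[OF le abs_ge_self])
qed (fact h)

lemma integrable_mult_cnj:
  assumes f: "f \<in> sq_integrable" and g: "g \<in> sq_integrable"
  shows "integrable circle (\<lambda>z. f z * cnj (g z))"
proof (rule integrable_sq_bound[OF f g, where c = 1])
  have [measurable]: "f \<in> borel_measurable circle" "g \<in> borel_measurable circle"
    using f g by (auto intro: sq_integrable_measurable)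
  show "(\<lambda>z. f z * cnj (g z)) \<in> borel_measurable circle"
    by measurable
  fix z
  have *: "0 \<le> p \<Longrightarrow> 2 * p \<le> q \<Longrightarrow> p \<le> q" for p q :: real
    by simp
  have "cmod (f z) * cmod (g z) \<le> (cmod (f z))\<^sup>2 + (cmod (g z))\<^sup>2"
    using sum_squares_bound[of "cmod (f z)" "cmod (g z)"]
    by (intro *[OF mult_nonneg_nonneg[OF norm_ge_zero norm_ge_zero]]) (simp only: mult.assoc)
  then show "cmod (f z * cnj (g z)) \<le> 1 * ((cmod (f z))\<^sup>2 + (cmod (g z))\<^sup>2)"
    by (simp add: norm_mult)
qed

lemma sq_integrable_0: "(\<lambda>_. 0) \<in> sq_integrable"
  by (simp add: sq_integrable_def)

lemma sq_integrable_add: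
  assumes f: "f \<in> sq_integrable" and g: "g \<in> sq_integrable"
  shows "(\<lambda>z. f z + g z) \<in> sq_integrable"
proof -
  have [measurable]: "f \<in> borel_measurable circle" "g \<in> borel_measurable circle"
    using f g by (auto intro: sq_integrable_measurable)
  have "integrable circle (\<lambda>z. (cmod (f z + g z))\<^sup>2)"
  proof (rule integrable_sq_bound[OF f g, where c = 2])
    show "(\<lambda>z. (cmod (f z + g z))\<^sup>2) \<in> borel_measurable circle" by measurable
    fix z
    have "(cmod (f z + g z))\<^sup>2 \<le> (cmod (f z) + cmod (g z))\<^sup>2"
      by (intro power_mono norm_triangle_ineq) auto
    also have "\<dots> \<le> 2 * ((cmod (f z))\<^sup>2 + (cmod (g z))\<^sup>2)"
      using sum_squares_bound[of "cmod (f z)" "cmod (g z)"] by (simp add: power2_sum)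
    finally show "norm ((cmod (f z + g z))\<^sup>2) \<le> 2 * ((cmod (f z))\<^sup>2 + (cmod (g z))\<^sup>2)"
      by simp
  qed
  then show ?thesis by (simp add: sq_integrable_def)
qed

lemma sq_integrable_mult:
  assumes a: "a \<in> Linf" and f: "f \<in> sq_integrable"
  shows "(\<lambda>z. a z * f z) \<in> sq_integrable"
proof -
  have [measurable]: "a \<in> borel_measurable circle" "f \<in> borel_measurable circle"
    using a f by (auto simp: Linf_def intro: sq_integrable_measurable)
  obtain C where C: "AE z in circle. cmod (a z) \<le> C"
    using a by (auto simp: Linf_def)
  have "integrable circle (\<lambda>z. (cmod (a z * f z))\<^sup>2)"
  proof (rule Bochner_Integration.integrable_bound)
    show "integrable circle (\<lambda>z. C\<^sup>2 * (cmod (f z))\<^sup>2)"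
      using f by (auto simp: sq_integrable_def)
    show "AE z in circle. norm ((cmod (a z * f z))\<^sup>2) \<le> norm (C\<^sup>2 * (cmod (f z))\<^sup>2)"
      using C
    proof eventually_elim
      case (elim z)
      then have "(cmod (a z))\<^sup>2 \<le> C\<^sup>2" by (intro power_mono) auto
      then show ?case
        by (simp add: norm_mult power_mult_distrib mult_right_mono)
    qed
  qed measurable
  then show ?thesis by (simp add: sq_integrable_def)
qed

lemma Linf_const: "(\<lambda>_. c) \<in> Linf"
  by (auto simp: Linf_def)

lemma sq_integrable_scale: "f \<in> sq_integrable \<Longrightarrow> (\<lambda>z. c * f z) \<in> sq_integrable"
  by (rule sq_integrable_mult[OF Linf_const])

quotient_type l2 = "complex \<Rightarrow> complex" / partial: l2_rel
proof (rule part_equivpI)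
  show "\<exists>f. l2_rel f f"
    using sq_integrable_0 by (auto simp: l2_rel_def)
  show "symp l2_rel"
    by (auto simp: l2_rel_def symp_def)
  show "transp l2_rel"
    by (auto simp: l2_rel_def transp_def)
qed

lift_definition cinner :: "l2 \<Rightarrow> l2 \<Rightarrow> complex" is
  "\<lambda>f g. \<integral>z. f z * cnj (g z) \<partial>circle"
proof -
  fix f f' g g' assume r: "l2_rel f f'" "l2_rel g g'"
  then have [measurable]: "f \<in> borel_measurable circle" "g \<in> borel_measurable circle"
    "f' \<in> borel_measurable circle" "g' \<in> borel_measurable circle"
    by (auto simp: l2_rel_def intro: sq_integrable_measurable)
  show "(\<integral>z. f z * cnj (g z) \<partial>circle) = (\<integral>z. f' z * cnj (g' z) \<partial>circle)"
    using r by (intro integral_cong_AE) (auto simp: l2_rel_def)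
qed

text \<open>
  Multiplication by a bounded function; for \<open>a \<notin> Linf\<close> the result is the junk value \<open>0\<close>.
  Complex scalars act on \<open>l2\<close> as constant multipliers.
\<close>

lift_definition mult_l2 :: "(complex \<Rightarrow> complex) \<Rightarrow> l2 \<Rightarrow> l2" (infixr "\<odot>" 75) is
  "\<lambda>a f. if a \<in> Linf then (\<lambda>z. a z * f z) else (\<lambda>_. 0)"
  by (auto simp: l2_rel_def sq_integrable_mult sq_integrable_0)

text \<open>
  The real inner product is the real part of the complex one, so that \<open>norm\<close> is the usual
  norm of \<open>L\<^sup>2\<close>.
\<close>

instantiation l2 :: real_inner
begin

lift_definition zero_l2 :: l2 is "\<lambda>_. 0"
  by (simp add: l2_rel_def sq_integrable_0)

lift_definition plus_l2 :: "l2 \<Rightarrow> l2 \<Rightarrow> l2" is "\<lambda>f g z. f z + g z"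
  by (auto simp: l2_rel_def sq_integrable_add)

lift_definition scaleR_l2 :: "real \<Rightarrow> l2 \<Rightarrow> l2" is "\<lambda>r f z. complex_of_real r * f z"
  by (auto simp: l2_rel_def intro!: sq_integrable_scale)

definition uminus_l2 :: "l2 \<Rightarrow> l2" where "uminus_l2 f = (-1) *\<^sub>R f"

definition minus_l2 :: "l2 \<Rightarrow> l2 \<Rightarrow> l2" where "minus_l2 f g = f + - g"

definition inner_l2 :: "l2 \<Rightarrow> l2 \<Rightarrow> real" where "inner_l2 f g = Re (cinner f g)"

definition norm_l2 :: "l2 \<Rightarrow> real" where "norm_l2 f = sqrt (inner f f)"

definition dist_l2 :: "l2 \<Rightarrow> l2 \<Rightarrow> real" where "dist_l2 f g = norm (f - g)"

definition sgn_l2 :: "l2 \<Rightarrow> l2" where "sgn_l2 f = inverse (norm f) *\<^sub>R f"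

definition uniformity_l2 :: "(l2 \<times> l2) filter" where
  "uniformity_l2 = (INF e\<in>{0<..}. principal {(f, g). dist f g < e})"

definition open_l2 :: "l2 set \<Rightarrow> bool" where
  "open_l2 U \<longleftrightarrow> (\<forall>f\<in>U. eventually (\<lambda>(f', g). f' = f \<longrightarrow> g \<in> U) uniformity)"

instance
proof
  fix f g h :: l2 and r s :: real
  show "f + g + h = f + (g + h)"
    by transfer (auto simp: l2_rel_def add.assoc sq_integrable_add)
  show "f + g = g + f"
    by transfer (auto simp: l2_rel_def add.commute sq_integrable_add)
  show "0 + f = f"
    by transfer (auto simp: l2_rel_def)
  show "- f + f = 0"
    unfolding uminus_l2_def
  proof transfer
    fix f assume "l2_rel f f"
    then have "(\<lambda>z. complex_of_real (- 1) * f z + f z) \<in> sq_integrable"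
      by (intro sq_integrable_add sq_integrable_scale) (auto simp: l2_rel_def)
    then show "l2_rel (\<lambda>z. complex_of_real (- 1) * f z + f z) (\<lambda>_. 0)"
      by (simp add: l2_rel_def sq_integrable_0)
  qed
  show "f - g = f + - g"
    by (simp add: minus_l2_def)
  show "r *\<^sub>R (f + g) = r *\<^sub>R f + r *\<^sub>R g"
  proof transfer
    fix r f g assume "l2_rel f f" "l2_rel g g"
    then have "(\<lambda>z. complex_of_real r * f z + complex_of_real r * g z) \<in> sq_integrable"
      by (intro sq_integrable_add sq_integrable_scale) (auto simp: l2_rel_def)
    then show "l2_rel (\<lambda>z. complex_of_real r * (f z + g z))
        (\<lambda>z. complex_of_real r * f z + complex_of_real r * g z)"
      by (simp add: l2_rel_def distrib_left)
  qed
  show "(r + s) *\<^sub>R f = r *\<^sub>R f + s *\<^sub>R f"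
  proof transfer
    fix r s f assume "l2_rel f f"
    then have "(\<lambda>z. complex_of_real r * f z + complex_of_real s * f z) \<in> sq_integrable"
      by (intro sq_integrable_add sq_integrable_scale) (auto simp: l2_rel_def)
    then show "l2_rel (\<lambda>z. complex_of_real (r + s) * f z)
        (\<lambda>z. complex_of_real r * f z + complex_of_real s * f z)"
      by (simp add: l2_rel_def distrib_right)
  qed
  show "r *\<^sub>R s *\<^sub>R f = (r * s) *\<^sub>R f"
  proof transfer
    fix r s f assume "l2_rel f f"
    then have "(\<lambda>z. complex_of_real r * (complex_of_real s * f z)) \<in> sq_integrable"
      by (intro sq_integrable_scale) (auto simp: l2_rel_def)
    then show "l2_rel (\<lambda>z. complex_of_real r * (complex_of_real s * f z))
        (\<lambda>z. complex_of_real (r * s) * f z)"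
      by (simp add: l2_rel_def mult.assoc)
  qed
  show "1 *\<^sub>R f = f"
    by transfer (auto simp: l2_rel_def)
  show "dist f g = norm (f - g)" by (simp add: dist_l2_def)
  show "sgn f = inverse (norm f) *\<^sub>R f" by (simp add: sgn_l2_def)
  show "(uniformity :: (l2 \<times> l2) filter) = (INF e\<in>{0<..}. principal {(f, g). dist f g < e})"
    by (simp add: uniformity_l2_def)
  show "inner f g = inner g f"
    unfolding inner_l2_def
  proof transfer
    fix f g assume "l2_rel f f" "l2_rel g g"
    have "Re (\<integral>z. f z * cnj (g z) \<partial>circle) = Re (cnj (\<integral>z. f z * cnj (g z) \<partial>circle))"
      by simp
    also have "cnj (\<integral>z. f z * cnj (g z) \<partial>circle) = (\<integral>z. g z * cnj (f z) \<partial>circle)"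
      using Bochner_Integration.integral_cnj[of circle "\<lambda>z. f z * cnj (g z)"] by (simp add: mult.commute del: Bochner_Integration.integral_cnj)
    finally show "Re (\<integral>z. f z * cnj (g z) \<partial>circle) = Re (\<integral>z. g z * cnj (f z) \<partial>circle)" .
  qed
  show "inner (f + g) h = inner f h + inner g h"
    unfolding inner_l2_def
    by transfer (simp add: l2_rel_def distrib_right integrable_mult_cnj)
  show "inner (r *\<^sub>R f) g = r * inner f g"
    unfolding inner_l2_def
    by transfer (simp add: l2_rel_def mult.assoc)
  have sq: "Re (\<integral>z. f z * cnj (f z) \<partial>circle) = (\<integral>z. (cmod (f z))\<^sup>2 \<partial>circle)" for f
  proof -
    have "(\<integral>z. f z * cnj (f z) \<partial>circle) = (\<integral>z. complex_of_real ((cmod (f z))\<^sup>2) \<partial>circle)"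
      by (simp only: complex_norm_square)
    then show ?thesis by (simp only: integral_complex_of_real Re_complex_of_real)
  qed
  show "0 \<le> inner f f"
    unfolding inner_l2_def by transfer (simp add: sq)
  show "inner f f = 0 \<longleftrightarrow> f = 0"
    unfolding inner_l2_def
  proof transfer
    fix f assume "l2_rel f f"
    then have f: "f \<in> sq_integrable" by (simp add: l2_rel_def)
    then have "(\<integral>z. (cmod (f z))\<^sup>2 \<partial>circle) = 0 \<longleftrightarrow> (AE z in circle. (cmod (f z))\<^sup>2 = 0)"
      by (intro integral_nonneg_eq_0_iff_AE) (auto simp: sq_integrable_def)
    then show "Re (\<integral>z. f z * cnj (f z) \<partial>circle) = 0 \<longleftrightarrow> l2_rel f (\<lambda>_. 0)"
      using f by (simp add: sq l2_rel_def sq_integrable_0)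
  qed
  show "norm f = sqrt (inner f f)" by (simp add: norm_l2_def)
next
  fix U :: "l2 set"
  show "open U \<longleftrightarrow> (\<forall>f\<in>U. eventually (\<lambda>(f', g). f' = f \<longrightarrow> g \<in> U) uniformity)"
    by (simp add: open_l2_def)
qed

end


section \<open>Hardy spaces, model spaces and projections\<close>

definition fourier_coeff :: "(complex \<Rightarrow> complex) \<Rightarrow> int \<Rightarrow> complex" where
  "fourier_coeff f n = (\<integral>z. f z * z powi (- n) \<partial>circle)"

definition Hinf :: "(complex \<Rightarrow> complex) set" where
  "Hinf = {a \<in> Linf. \<forall>n<0. fourier_coeff a n = 0}"

definition is_inner_function :: "(complex \<Rightarrow> complex) \<Rightarrow> bool" where
  "is_inner_function \<theta> \<longleftrightarrow> \<theta> \<in> Hinf \<and> unimodular \<theta>"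

text \<open>\<open>rep_l2\<close> chooses a representative; Fourier coefficients do not depend on it.\<close>

definition H2 :: "l2 set" where
  "H2 = {f. \<forall>n<0. fourier_coeff (rep_l2 f) n = 0}"

definition K_space :: "(complex \<Rightarrow> complex) \<Rightarrow> l2 set" where
  "K_space \<theta> = {f \<in> H2. \<forall>h\<in>H2. cinner f (\<theta> \<odot> h) = 0}"

text \<open>The orthogonal projection onto a closed subspace.\<close>

definition proj :: "l2 set \<Rightarrow> l2 \<Rightarrow> l2" where
  "proj V f = (THE p. p \<in> V \<and> (\<forall>v\<in>V. cinner (f - p) v = 0))"

definition M_space ::
  "(complex \<Rightarrow> complex) \<Rightarrow> (complex \<Rightarrow> complex) \<Rightarrow> (complex \<Rightarrow> complex) \<Rightarrow> l2 set" where
  "M_space \<theta> \<phi> \<psi> = {\<phi> \<odot> k + \<psi> \<odot> l | k l. k \<in> K_space \<theta> \<and> l \<in> K_space \<theta>}"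


section \<open>Operators\<close>

definition compression :: "l2 set \<Rightarrow> (complex \<Rightarrow> complex) \<Rightarrow> l2 \<Rightarrow> l2" where
  "compression M g f = proj M (g \<odot> f)"

definition H2_vec :: "(l2 ^ 'n) set" where
  "H2_vec = {x. \<forall>i. x $ i \<in> H2}"

definition toeplitz :: "(complex \<Rightarrow> complex) ^ 'n ^ 'n \<Rightarrow> l2 ^ 'n \<Rightarrow> l2 ^ 'n" where
  "toeplitz G x = (\<chi> i. proj H2 (\<Sum>j\<in>UNIV. G $ i $ j \<odot> x $ j))"

text \<open>Invertibility of a linear operator on \<open>V\<close>: bijective with bounded inverse.\<close>

definition invertible_on :: "'a::real_normed_vector set \<Rightarrow> ('a \<Rightarrow> 'a) \<Rightarrow> bool" where
  "invertible_on V T \<longleftrightarrow>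
     bij_betw T V V \<and> (\<exists>C. \<forall>y\<in>V. norm (inv_into V T y) \<le> C * norm y)"

definition G_symbol ::
  "(complex \<Rightarrow> complex) \<Rightarrow> (complex \<Rightarrow> complex) \<Rightarrow> (complex \<Rightarrow> complex) \<Rightarrow>
   (complex \<Rightarrow> complex) \<Rightarrow> (complex \<Rightarrow> complex) ^ 4 ^ 4" where
  "G_symbol \<theta> \<phi> \<psi> g = vector
     [vector [\<lambda>z. cnj (\<theta> z), 0, 0, 0],
      vector [0, \<lambda>z. cnj (\<theta> z), 0, 0],
      vector [g, \<lambda>z. g z * cnj (\<phi> z) * \<psi> z, \<theta>, 0],
      vector [\<lambda>z. g z * \<phi> z * cnj (\<psi> z), g, 0, \<theta>]]"

definition U0 ::
  "(complex \<Rightarrow> complex) \<Rightarrow> (complex \<Rightarrow> complex) \<Rightarrow> (complex \<Rightarrow> complex) \<Rightarrow> l2 \<Rightarrow> l2 ^ 4" where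
  "U0 \<theta> \<phi> \<psi> h = vector
     [0, 0, proj (K_space \<theta>) ((\<lambda>z. cnj (\<phi> z)) \<odot> h), proj (K_space \<theta>) ((\<lambda>z. cnj (\<psi> z)) \<odot> h)]"

end

theory Submission
  imports Defs "HOL-Probability.Probability_Measure"
begin

text \<open>
  If \<open>T\<^sub>G x = y\<close>, the first two rows say that \<open>x\<^sub>j = \<theta> y\<^sub>j + k\<^sub>j\<close> with \<open>k\<^sub>j = P\<^sub>\<theta> x\<^sub>j\<close>. Since
  \<open>P\<^sup>+ w = P\<^sub>\<theta> w + \<theta> P\<^sup>+ (cnj \<theta> w)\<close>, each of the last two rows splits: its \<open>\<theta> H\<^sup>2\<close> part determines \<open>x\<^sub>3\<close> and
  \<open>x\<^sub>4\<close>, and its \<open>K\<^sub>\<theta>\<close> part is the equation \<open>T (\<phi> k\<^sub>1 + \<psi> k\<^sub>2) = \<Phi> y\<close> in \<open>M\<close>, with \<open>\<Phi>\<close> bounded and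
  \<open>\<Phi> (U\<^sub>0 h) = h\<close>. The only analytic inputs are that \<open>L\<^sup>2\<close> is complete, so that \<open>P\<^sup>+\<close> exists, and
  that \<open>\<theta> H\<^sup>2 \<subseteq> H\<^sup>2\<close>, which rests on the completeness of the trigonometric system.
\<close>

section \<open>Orthogonal projections in a Hilbert space\<close>

text \<open>The map sending \<open>x\<close> to \<open>(G x, J x)\<close> identifies
  \<open>H2_vec\<close> with the pairs \<open>(y, m)\<close> in \<open>H2_vec\<close> and
  \<open>M\<close> that satisfy \<open>T m = \<Phi> y\<close>, and \<open>R\<close> is its inverse.
  So for fixed \<open>y\<close> the solutions of \<open>G x = y\<close> correspond one to one to
  those of \<open>T m = \<Phi> y\<close>; this carries bijectivity from \<open>T\<close> to
  \<open>G\<close>, and the right inverse of \<open>\<Phi>\<close> carries it back. Boundedness of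
  the inverses follows because all linking maps are bounded, so this part is linear algebra in
  normed spaces. Function theory is needed to make the projections exist: \<open>proj\<close> is a
  definite description and yields nothing before a witness is found. For \<open>H2\<close> the
  witness comes from a minimising sequence, for the model space and for \<open>M\<close> from
  explicit formulas. Since \<open>H2\<close> is defined by vanishing coefficients, its invariance
  under \<open>\<theta>\<close> cannot be seen pointwise; it is obtained by duality, from the
  orthogonality to \<open>H2\<close> of every function without nonnegative coefficients.\<close>

lemma hilbert_projection_exists:
  fixes S :: "'a::{real_inner, complete_space} set"
  assumes S: "subspace S" and cl: "closed S"
  shows "\<exists>p\<in>S. \<forall>v\<in>S. inner (f - p) v = 0"
proof -
  define d where "d = infdist f S"
  have ne: "S \<noteq> {}" using subspace_0[OF S] by auto
  have dle: "d \<le> norm (f - v)" if "v \<in> S" for v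
    using infdist_le[OF that, of f] by (simp add: d_def dist_norm)
  have d0: "0 \<le> d" by (simp add: d_def infdist_nonneg)
  have "\<exists>v\<in>S. norm (f - v) < d + 1 / real (Suc n)" for n
  proof -
    have "(INF v\<in>S. dist f v) < d + 1 / real (Suc n)"
      using ne by (simp add: d_def infdist_def)
    then show ?thesis
      using ne by (subst (asm) cINF_less_iff) (auto simp: dist_norm intro!: bdd_belowI[of _ 0])
  qed
  then obtain s where s: "\<And>n. s n \<in> S" "\<And>n. norm (f - s n) < d + 1 / real (Suc n)"
    by metis
  \<comment> \<open>Parallelogram law for \<open>f - s m\<close> and \<open>f - s n\<close>: the
    midpoint of \<open>s m\<close> and \<open>s n\<close> lies in \<open>S\<close>, so its distance
    to \<open>f\<close> is at least \<open>d\<close>. Since \<open>norm (f - s n)\<close> tends to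
    \<open>d\<close>, a minimising sequence must be Cauchy.\<close>
  have par: "(norm (s m - s n))\<^sup>2 \<le> 2 * ((norm (f - s m))\<^sup>2 - d\<^sup>2) + 2 * ((norm (f - s n))\<^sup>2 - d\<^sup>2)"
    for m n
  proof -
    define a b where "a = f - s m" and "b = f - s n"
    have "(1/2) *\<^sub>R (s m + s n) \<in> S"
      using S s by (simp add: subspace_add subspace_scale)
    then have "d \<le> norm (f - (1/2) *\<^sub>R (s m + s n))" by (rule dle)
    also have "f - (1/2) *\<^sub>R (s m + s n) = (1/2) *\<^sub>R (a + b)"
    proof -
      have "f = (1/2) *\<^sub>R (f + f)" by (simp add: scaleR_2[symmetric])
      then show ?thesis
        unfolding a_def b_def scaleR_diff_right scaleR_add_right by (simp add: algebra_simps)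
    qed
    finally have "2 * d \<le> norm (a + b)" by simp
    then have "(2 * d)\<^sup>2 \<le> (norm (a + b))\<^sup>2" using d0 by (intro power_mono) auto
    then have "4 * d\<^sup>2 \<le> (norm (a + b))\<^sup>2" by (simp add: power_mult_distrib)
    moreover have "(norm (a - b))\<^sup>2 + (norm (a + b))\<^sup>2 = 2 * (norm a)\<^sup>2 + 2 * (norm b)\<^sup>2"
      by (simp add: power2_norm_eq_inner inner_simps inner_commute[of b a])
    moreover have "norm (s m - s n) = norm (a - b)"
      by (simp add: a_def b_def norm_minus_commute)
    ultimately show ?thesis unfolding a_def[symmetric] b_def[symmetric] by simp
  qed
  have lim: "(\<lambda>n. (norm (f - s n))\<^sup>2) \<longlonglongrightarrow> d\<^sup>2"
  proof (rule tendsto_power, rule tendsto_sandwich[OF _ _ tendsto_const])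
    show "\<forall>\<^sub>F n in sequentially. d \<le> norm (f - s n)" using dle s by auto
    show "\<forall>\<^sub>F n in sequentially. norm (f - s n) \<le> d + 1 / real (Suc n)"
      using less_imp_le[OF s(2)] by (rule always_eventually[OF allI])
    show "(\<lambda>n. d + 1 / real (Suc n)) \<longlonglongrightarrow> d"
      using tendsto_add[OF tendsto_const LIMSEQ_inverse_real_of_nat, of d]
      by (simp add: inverse_eq_divide)
  qed
  have "Cauchy s"
  proof (rule metric_CauchyI)
    fix e :: real assume "0 < e"
    then have "0 < e\<^sup>2 / 4" by simp
    then obtain N where N: "\<And>n. n \<ge> N \<Longrightarrow> \<bar>(norm (f - s n))\<^sup>2 - d\<^sup>2\<bar> < e\<^sup>2 / 4"
      using LIMSEQ_D[OF lim] unfolding real_norm_def by blast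
    have "dist (s m) (s n) < e" if "m \<ge> N" "n \<ge> N" for m n
    proof -
      have "(norm (s m - s n))\<^sup>2 < e\<^sup>2"
        using par[of m n] N[OF that(1), THEN abs_less_iff[THEN iffD1]]
          N[OF that(2), THEN abs_less_iff[THEN iffD1]] by (simp add: algebra_simps)
      then show ?thesis using \<open>0 < e\<close> by (simp add: dist_norm power2_less_imp_less)
    qed
    then show "\<exists>N. \<forall>m\<ge>N. \<forall>n\<ge>N. dist (s m) (s n) < e" by blast
  qed
  then obtain p where p: "s \<longlonglongrightarrow> p"
    unfolding Cauchy_convergent_iff convergent_def by blast
  then have pS: "p \<in> S"
    using closed_sequentially[OF cl s(1)] by simp
  have "(\<lambda>n. (norm (f - s n))\<^sup>2) \<longlonglongrightarrow> (norm (f - p))\<^sup>2"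
    using p by (intro tendsto_intros)
  then have nd: "(norm (f - p))\<^sup>2 = d\<^sup>2"
    using lim LIMSEQ_unique by blast
  have "inner (f - p) v = 0" if v: "v \<in> S" for v
  proof (cases "v = 0")
    case False
    \<comment> \<open>The minimiser of the quadratic \<open>norm (f - p - t v)\<close> squared in
      \<open>t\<close>; any nonzero inner product would push the value below the minimal
      distance.\<close>
    define t where "t = inner (f - p) v / (norm v)\<^sup>2"
    have "p + t *\<^sub>R v \<in> S" using S pS v by (simp add: subspace_add subspace_scale)
    then have "d\<^sup>2 \<le> (norm (f - (p + t *\<^sub>R v)))\<^sup>2"
      using d0 dle by (intro power_mono) auto
    also have "\<dots> = (norm (f - p))\<^sup>2 - 2 * t * inner (f - p) v + t\<^sup>2 * (norm v)\<^sup>2"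
      unfolding diff_diff_eq[symmetric] power2_norm_eq_inner
      by (simp only: inner_diff_left[of "f - p"] inner_diff_right[of _ "f - p"] inner_scaleR_left
          inner_scaleR_right inner_commute[of v "f - p"]) (simp add: algebra_simps power2_eq_square)
    also have "\<dots> = d\<^sup>2 - (inner (f - p) v)\<^sup>2 / (norm v)\<^sup>2"
      unfolding nd using False by (simp add: t_def power2_eq_square)
    finally have "(inner (f - p) v)\<^sup>2 / (norm v)\<^sup>2 \<le> 0" by simp
    then show ?thesis using False by (simp add: divide_le_0_iff)
  qed simp
  with pS show ?thesis by blast
qed

section \<open>The Hilbert space of the circle\<close>

lemma cis_measurable [measurable]: "cis \<in> borel_measurable borel"
  by (intro borel_measurable_continuous_onI continuous_intros)

lemma prob_space_circle: "prob_space circle"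
  unfolding circle_def
  by (intro prob_space.prob_space_distr prob_space_uniform_measure) auto

interpretation circle: prob_space circle
  by (rule prob_space_circle)

lemma AE_circle_norm: "AE z in circle. cmod z = 1"
  unfolding circle_def by (subst AE_distr_iff) auto

lemma sq_integrable_imp_integrable:
  assumes "f \<in> sq_integrable"
  shows "integrable circle f"
proof -
  have "(\<lambda>_. 1) \<in> sq_integrable" by (simp add: sq_integrable_def)
  from integrable_mult_cnj[OF assms this] show ?thesis by simp
qed

lemma l2_rel_rep: "l2_rel (rep_l2 f) (rep_l2 f)"
  using Quotient3_rep_reflp[OF Quotient3_l2] .

lemma rep_l2_sq_integrable: "rep_l2 f \<in> sq_integrable"
  using l2_rel_rep[of f] by (simp add: l2_rel_def)

lemma abs_rep_l2 [simp]: "abs_l2 (rep_l2 f) = f"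
  using Quotient3_abs_rep[OF Quotient3_l2] .

lemma l2_cases:
  obtains h where "h \<in> sq_integrable" "f = abs_l2 h"
  by (rule that[of "rep_l2 f"]) (simp_all add: rep_l2_sq_integrable)

lemma abs_l2_eqI:
  assumes "f \<in> sq_integrable" "g \<in> sq_integrable" "AE z in circle. f z = g z"
  shows "abs_l2 f = abs_l2 g"
  using assms by (intro Quotient3_rel_abs[OF Quotient3_l2]) (simp add: l2_rel_def)

lemma cinner_abs_l2:
  assumes "f \<in> sq_integrable" "g \<in> sq_integrable"
  shows "cinner (abs_l2 f) (abs_l2 g) = (\<integral>z. f z * cnj (g z) \<partial>circle)"
  using assms by (simp add: cinner.abs_eq l2_rel_def)

lemma mult_abs_l2:
  assumes "f \<in> sq_integrable" "a \<in> Linf"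
  shows "a \<odot> abs_l2 f = abs_l2 (\<lambda>z. a z * f z)"
  using assms by (simp add: mult_l2.abs_eq l2_rel_def)

lemma add_abs_l2:
  assumes "f \<in> sq_integrable" "g \<in> sq_integrable"
  shows "abs_l2 f + abs_l2 g = abs_l2 (\<lambda>z. f z + g z)"
  using assms by (simp add: plus_l2.abs_eq l2_rel_def)

lemma scaleR_abs_l2:
  assumes "f \<in> sq_integrable"
  shows "r *\<^sub>R abs_l2 f = abs_l2 (\<lambda>z. of_real r * f z)"
  using assms by (simp add: scaleR_l2.abs_eq l2_rel_def)

lemma sq_integrable_diff:
  assumes "f \<in> sq_integrable" "g \<in> sq_integrable"
  shows "(\<lambda>z. f z - g z) \<in> sq_integrable"
  using sq_integrable_add[OF assms(1) sq_integrable_scale[OF assms(2), of "-1"]] by simp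

lemma diff_abs_l2:
  assumes "f \<in> sq_integrable" "g \<in> sq_integrable"
  shows "abs_l2 f - abs_l2 g = abs_l2 (\<lambda>z. f z - g z)"
  using add_abs_l2[OF assms(1) sq_integrable_scale[OF assms(2), of "-1"]]
  unfolding minus_l2_def uminus_l2_def scaleR_abs_l2[OF assms(2)] by simp

lemma norm_abs_l2:
  assumes "f \<in> sq_integrable"
  shows "(norm (abs_l2 f))\<^sup>2 = (\<integral>z. (cmod (f z))\<^sup>2 \<partial>circle)"
proof -
  have "(\<integral>z. f z * cnj (f z) \<partial>circle) = (\<integral>z. complex_of_real ((cmod (f z))\<^sup>2) \<partial>circle)"
    by (simp only: complex_norm_square)
  then have "Re (\<integral>z. f z * cnj (f z) \<partial>circle) = (\<integral>z. (cmod (f z))\<^sup>2 \<partial>circle)"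
    by (simp only: integral_complex_of_real Re_complex_of_real)
  then show ?thesis
    by (simp add: power2_norm_eq_inner inner_l2_def cinner_abs_l2 assms)
qed

text \<open>The variance of \<open>cmod f\<close> under a probability measure is nonnegative. The
  bound makes L2-Cauchy sequences L1-Cauchy, which is what yields almost everywhere convergent
  subsequences.\<close>

lemma L1_norm_le_norm_abs_l2:
  assumes f: "f \<in> sq_integrable"
  shows "(\<integral>z. cmod (f z) \<partial>circle) \<le> norm (abs_l2 f)"
proof -
  have i: "integrable circle (\<lambda>z. cmod (f z))"
    using sq_integrable_imp_integrable[OF f] by simp
  have i2: "integrable circle (\<lambda>z. (cmod (f z))\<^sup>2)"
    using f by (simp add: sq_integrable_def)
  have "0 \<le> (\<integral>z. (cmod (f z) - (\<integral>z. cmod (f z) \<partial>circle))\<^sup>2 \<partial>circle)"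
    by simp
  also have "\<dots> = (\<integral>z. (cmod (f z))\<^sup>2 \<partial>circle) - (\<integral>z. cmod (f z) \<partial>circle)\<^sup>2"
    using circle.variance_eq[OF i i2] .
  finally have "(\<integral>z. cmod (f z) \<partial>circle)\<^sup>2 \<le> (norm (abs_l2 f))\<^sup>2"
    by (simp add: norm_abs_l2 f)
  then show ?thesis by (rule power2_le_imp_le) simp
qed

text \<open>Riesz-Fischer: representatives of a Cauchy sequence are L1-Cauchy, a subsequence
  converges almost everywhere, and its pointwise limit is the candidate.\<close>

instance l2 :: complete_space
proof
  fix X :: "nat \<Rightarrow> l2" assume C: "Cauchy X"
  define x where "x n = rep_l2 (X n)" for n
  have sq: "x n \<in> sq_integrable" for n by (simp add: x_def rep_l2_sq_integrable)
  have X: "X n = abs_l2 (x n)" for n by (simp add: x_def)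
  have [measurable]: "x n \<in> borel_measurable circle" for n
    by (rule sq_integrable_measurable[OF sq])
  have dX: "norm (X m - X n) = norm (abs_l2 (\<lambda>z. x m z - x n z))" for m n
    by (simp add: X diff_abs_l2 sq)
  have L1: "(\<integral>z. norm (x i z - x j z) \<partial>circle) \<le> norm (X i - X j)" for i j
    unfolding dX by (rule L1_norm_le_norm_abs_l2[OF sq_integrable_diff[OF sq sq]])
  have "\<exists>N. \<forall>i\<ge>N. \<forall>j\<ge>N. (\<integral>z. norm (x i z - x j z) \<partial>circle) < e" if e: "e > 0" for e
  proof -
    obtain N where "\<And>i j. i \<ge> N \<Longrightarrow> j \<ge> N \<Longrightarrow> norm (X i - X j) < e"
      using CauchyD[OF C e] by blast
    then have "\<forall>i\<ge>N. \<forall>j\<ge>N. (\<integral>z. norm (x i z - x j z) \<partial>circle) < e"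
      using L1 by (intro allI impI order.strict_trans1[OF L1]) auto
    then show ?thesis by blast
  qed
  from cauchy_L1_AE_cauchy_subseq[OF sq_integrable_imp_integrable[OF sq] this]
  obtain r where r: "strict_mono r" and ae: "AE z in circle. Cauchy (\<lambda>i. x (r i) z)"
    by blast
  define y where "y z = lim (\<lambda>i. x (r i) z)" for z
  have [measurable]: "y \<in> borel_measurable circle"
    unfolding y_def by measurable
  have ae_lim: "AE z in circle. (\<lambda>i. x (r i) z) \<longlonglongrightarrow> y z"
    using ae by eventually_elim (simp add: y_def Cauchy_convergent_iff convergent_LIMSEQ_iff)
  \<comment> \<open>Fatou's lemma carries the Cauchy estimate over to the limit. Working with the
    nonnegative integral allows this before \<open>y\<close> is known to be square integrable; the
    estimate then gives both that and convergence.\<close>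
  have key: "(\<integral>\<^sup>+z. ennreal ((cmod (y z - x n z))\<^sup>2) \<partial>circle) \<le> ennreal (e\<^sup>2)"
    if e: "e > 0" and N: "\<And>m n. m \<ge> N \<Longrightarrow> n \<ge> N \<Longrightarrow> norm (X m - X n) < e" and n: "n \<ge> N" for e n N
  proof -
    have "(\<integral>\<^sup>+z. ennreal ((cmod (y z - x n z))\<^sup>2) \<partial>circle)
        = (\<integral>\<^sup>+z. liminf (\<lambda>i. ennreal ((cmod (x (r i) z - x n z))\<^sup>2)) \<partial>circle)"
    proof (rule nn_integral_cong_AE)
      show "AE z in circle. ennreal ((cmod (y z - x n z))\<^sup>2)
          = liminf (\<lambda>i. ennreal ((cmod (x (r i) z - x n z))\<^sup>2))"
        using ae_lim
      proof eventually_elim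
        case (elim z)
        then have "(\<lambda>i. ennreal ((cmod (x (r i) z - x n z))\<^sup>2)) \<longlonglongrightarrow> ennreal ((cmod (y z - x n z))\<^sup>2)"
          by (intro tendsto_intros)
        then show ?case by (intro lim_imp_Liminf[symmetric]) auto
      qed
    qed
    also have "\<dots> \<le> liminf (\<lambda>i. \<integral>\<^sup>+z. ennreal ((cmod (x (r i) z - x n z))\<^sup>2) \<partial>circle)"
      by (intro nn_integral_liminf) measurable
    also have "\<dots> \<le> limsup (\<lambda>i. \<integral>\<^sup>+z. ennreal ((cmod (x (r i) z - x n z))\<^sup>2) \<partial>circle)"
      by (intro Liminf_le_Limsup) simp
    also have "\<dots> \<le> ennreal (e\<^sup>2)"
    proof (rule Limsup_bounded)
      have "(\<integral>\<^sup>+z. ennreal ((cmod (x (r i) z - x n z))\<^sup>2) \<partial>circle) \<le> ennreal (e\<^sup>2)" if "i \<ge> N" for i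
      proof -
        have "r i \<ge> N" using that seq_suble[OF r, of i] by linarith
        then have "(norm (X (r i) - X n))\<^sup>2 \<le> e\<^sup>2"
          using N n by (intro power_mono) (auto intro: less_imp_le)
        moreover have "(\<integral>\<^sup>+z. ennreal ((cmod (x (r i) z - x n z))\<^sup>2) \<partial>circle)
            = ennreal ((norm (X (r i) - X n))\<^sup>2)"
          using sq_integrable_diff[OF sq sq, of "r i" n]
          by (simp add: dX norm_abs_l2 nn_integral_eq_integral sq_integrable_def)
        ultimately show ?thesis by (simp add: ennreal_leI)
      qed
      then show "\<forall>\<^sub>F i in sequentially. (\<integral>\<^sup>+z. ennreal ((cmod (x (r i) z - x n z))\<^sup>2) \<partial>circle) \<le> ennreal (e\<^sup>2)"
        by (intro eventually_sequentiallyI)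
    qed
    finally show ?thesis .
  qed
  have ysq: "(\<lambda>z. y z - x n z) \<in> sq_integrable"
    if e: "e > 0" and N: "\<And>m n. m \<ge> N \<Longrightarrow> n \<ge> N \<Longrightarrow> norm (X m - X n) < e" and n: "n \<ge> N" for e n N
    using key[OF that]
    by (auto simp: sq_integrable_def integrable_iff_bounded le_less_trans)
  obtain N1 where N1: "\<And>m n. m \<ge> N1 \<Longrightarrow> n \<ge> N1 \<Longrightarrow> norm (X m - X n) < 1"
    using CauchyD[OF C, of 1] by auto
  have y: "y \<in> sq_integrable"
    using sq_integrable_add[OF ysq[OF zero_less_one, of N1 N1] sq[of N1]] N1 by simp
  have "X \<longlonglongrightarrow> abs_l2 y"
  proof (rule metric_LIMSEQ_I)
    fix e :: real assume "0 < e"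
    \<comment> \<open>Fatou's lemma only leaves a non-strict bound, hence half of
      \<open>e\<close>.\<close>
    then have e2: "0 < e/2" by simp
    obtain N where N: "\<And>m n. m \<ge> N \<Longrightarrow> n \<ge> N \<Longrightarrow> norm (X m - X n) < e/2"
      using CauchyD[OF C e2] by auto
    have "dist (X n) (abs_l2 y) < e" if n: "n \<ge> N" for n
    proof -
      note d = ysq[OF e2 N n]
      have "ennreal ((norm (abs_l2 y - X n))\<^sup>2) = (\<integral>\<^sup>+z. ennreal ((cmod (y z - x n z))\<^sup>2) \<partial>circle)"
        using norm_abs_l2[OF d] d
        by (simp add: X diff_abs_l2[OF y sq] nn_integral_eq_integral sq_integrable_def)
      also have "\<dots> \<le> ennreal ((e/2)\<^sup>2)" by (rule key[OF e2 N n])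
      finally have "(norm (abs_l2 y - X n))\<^sup>2 \<le> (e/2)\<^sup>2" by (simp add: ennreal_le_iff)
      then have "norm (abs_l2 y - X n) \<le> e/2" by (rule power2_le_imp_le) (use e2 in simp)
      then show ?thesis using \<open>0 < e\<close> by (simp add: dist_commute dist_norm)
    qed
    then show "\<exists>N. \<forall>n\<ge>N. dist (X n) (abs_l2 y) < e" by blast
  qed
  then show "convergent X" by (rule convergentI)
qed

section \<open>Bounded multipliers and the complex inner product\<close>

lemma Linf_measurable: "a \<in> Linf \<Longrightarrow> a \<in> borel_measurable circle"
  by (simp add: Linf_def)

lemma Linf_bound:
  assumes "a \<in> Linf"
  obtains C where "0 \<le> C" "AE z in circle. cmod (a z) \<le> C"
proof -
  obtain C where "AE z in circle. cmod (a z) \<le> C"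
    using assms by (auto simp: Linf_def)
  then have "AE z in circle. cmod (a z) \<le> max C 0"
    by eventually_elim simp
  then show thesis by (rule that[rotated]) simp
qed

lemma Linf_mult:
  assumes a: "a \<in> Linf" and b: "b \<in> Linf"
  shows "(\<lambda>z. a z * b z) \<in> Linf"
proof -
  obtain C where C: "0 \<le> C" "AE z in circle. cmod (a z) \<le> C" by (rule Linf_bound[OF a])
  obtain D where D: "0 \<le> D" "AE z in circle. cmod (b z) \<le> D" by (rule Linf_bound[OF b])
  have "AE z in circle. cmod (a z * b z) \<le> C * D"
    using C(2) D(2)
    by eventually_elim (use C D in \<open>auto simp: norm_mult intro: mult_mono\<close>)
  then show ?thesis
    using Linf_measurable[OF a] Linf_measurable[OF b] by (auto simp: Linf_def)
qed

lemma Linf_cnj: "a \<in> Linf \<Longrightarrow> (\<lambda>z. cnj (a z)) \<in> Linf"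
  by (auto simp: Linf_def)

lemma Linf_sq_integrable: "a \<in> Linf \<Longrightarrow> a \<in> sq_integrable"
  using sq_integrable_mult[of a "\<lambda>_. 1"] by (simp add: sq_integrable_def)

lemma cinner_commute: "cinner f g = cnj (cinner g f)"
proof (cases f rule: l2_cases, cases g rule: l2_cases)
  fix u v assume "u \<in> sq_integrable" "f = abs_l2 u" "v \<in> sq_integrable" "g = abs_l2 v"
  then show ?thesis
    using Bochner_Integration.integral_cnj[of circle "\<lambda>z. v z * cnj (u z)"]
    by (simp add: cinner_abs_l2 mult.commute del: Bochner_Integration.integral_cnj)
qed

lemma cinner_add_left: "cinner (f + g) h = cinner f h + cinner g h"
proof (cases f rule: l2_cases, cases g rule: l2_cases, cases h rule: l2_cases)
  fix u v w assume "u \<in> sq_integrable" "f = abs_l2 u" "v \<in> sq_integrable" "g = abs_l2 v"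
    "w \<in> sq_integrable" "h = abs_l2 w"
  then show ?thesis
    by (simp add: cinner_abs_l2 add_abs_l2 sq_integrable_add distrib_right integrable_mult_cnj)
qed

lemma cinner_add_right: "cinner f (g + h) = cinner f g + cinner f h"
  using cinner_add_left[of g h f] by (simp add: cinner_commute[of f])

lemma cinner_mult_left:
  assumes "a \<in> Linf"
  shows "cinner (a \<odot> f) g = cinner f ((\<lambda>z. cnj (a z)) \<odot> g)"
proof (cases f rule: l2_cases, cases g rule: l2_cases)
  fix u v assume "u \<in> sq_integrable" "f = abs_l2 u" "v \<in> sq_integrable" "g = abs_l2 v"
  then show ?thesis
    using assms
    by (simp add: cinner_abs_l2 mult_abs_l2 Linf_cnj sq_integrable_mult) (simp add: mult_ac)
qed

lemma mult_l2_add_right: "a \<odot> (f + g) = a \<odot> f + a \<odot> g"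
proof (cases "a \<in> Linf")
  case True
  show ?thesis
  proof (cases f rule: l2_cases, cases g rule: l2_cases)
    fix u v assume "u \<in> sq_integrable" "f = abs_l2 u" "v \<in> sq_integrable" "g = abs_l2 v"
    then show ?thesis
      using True
      by (simp add: mult_abs_l2 add_abs_l2 sq_integrable_add sq_integrable_mult distrib_left)
  qed
next
  case False
  then have "a \<odot> h = 0" for h
    by transfer (simp add: l2_rel_def sq_integrable_0)
  then show ?thesis by simp
qed

lemma mult_l2_cong:
  assumes "a \<in> Linf" "b \<in> Linf" "AE z in circle. a z = b z"
  shows "a \<odot> f = b \<odot> f"
proof (cases f rule: l2_cases)
  fix u assume u: "u \<in> sq_integrable" "f = abs_l2 u"
  have "AE z in circle. a z * u z = b z * u z"
    using assms(3) by eventually_elim simp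
  then show ?thesis
    using u assms by (simp add: mult_abs_l2) (intro abs_l2_eqI sq_integrable_mult; simp)
qed

lemma mult_l2_mult:
  assumes "a \<in> Linf" "b \<in> Linf"
  shows "a \<odot> b \<odot> f = (\<lambda>z. a z * b z) \<odot> f"
proof (cases f rule: l2_cases)
  fix u assume "u \<in> sq_integrable" "f = abs_l2 u"
  then show ?thesis
    using assms by (simp add: mult_abs_l2 Linf_mult sq_integrable_mult mult.assoc)
qed

lemma mult_l2_const: "(\<lambda>_. complex_of_real r) \<odot> f = r *\<^sub>R f"
proof (cases f rule: l2_cases)
  fix u assume "u \<in> sq_integrable" "f = abs_l2 u"
  then show ?thesis by (simp add: mult_abs_l2 scaleR_abs_l2 Linf_const)
qed

lemma mult_l2_one: "(\<lambda>_. 1) \<odot> f = f"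
  using mult_l2_const[of 1 f] by simp

text \<open>The left \<open>0\<close> is the zero function, the form in which the vanishing entries
  of \<open>G_symbol\<close> occur.\<close>

lemma mult_l2_zero_left: "0 \<odot> f = 0"
  using mult_l2_const[of 0 f] by (simp add: zero_fun_def)

lemma mult_l2_scaleR:
  "a \<odot> (r *\<^sub>R f) = r *\<^sub>R (a \<odot> f)"
proof (cases "a \<in> Linf")
  case True
  then show ?thesis
    by (simp add: mult_l2_const[symmetric] mult_l2_mult Linf_const mult.commute)
next
  case False
  then have "a \<odot> h = 0" for h
    by transfer (simp add: l2_rel_def sq_integrable_0)
  then show ?thesis by simp
qed

lemma norm_mult_l2_le:
  assumes a: "a \<in> Linf" and C: "0 \<le> C" "AE z in circle. cmod (a z) \<le> C"
  shows "norm (a \<odot> f) \<le> C * norm f"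
proof (cases f rule: l2_cases)
  fix u assume u: "u \<in> sq_integrable" "f = abs_l2 u"
  have "(norm (a \<odot> f))\<^sup>2 = (\<integral>z. (cmod (a z * u z))\<^sup>2 \<partial>circle)"
    using u a by (simp add: mult_abs_l2 norm_abs_l2 sq_integrable_mult)
  also have "\<dots> \<le> (\<integral>z. C\<^sup>2 * (cmod (u z))\<^sup>2 \<partial>circle)"
  proof (rule integral_mono_AE)
    show "integrable circle (\<lambda>z. (cmod (a z * u z))\<^sup>2)"
      using sq_integrable_mult[OF a u(1)] by (simp add: sq_integrable_def)
    show "integrable circle (\<lambda>z. C\<^sup>2 * (cmod (u z))\<^sup>2)"
      using u(1) by (simp add: sq_integrable_def)
    show "AE z in circle. (cmod (a z * u z))\<^sup>2 \<le> C\<^sup>2 * (cmod (u z))\<^sup>2"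
      using C(2)
      by eventually_elim (simp add: norm_mult power_mult_distrib mult_right_mono power_mono)
  qed
  also have "\<dots> = (C * norm f)\<^sup>2"
    using u by (simp add: norm_abs_l2 power_mult_distrib)
  finally show ?thesis
    by (rule power2_le_imp_le) (use C in simp)
qed

lemma bounded_linear_mult_l2:
  assumes "a \<in> Linf"
  shows "bounded_linear (mult_l2 a)"
proof -
  obtain C where "0 \<le> C" "AE z in circle. cmod (a z) \<le> C" by (rule Linf_bound[OF assms])
  then show ?thesis
    using norm_mult_l2_le[OF assms, of C]
    by (intro bounded_linear_intro[where K = C]) (auto simp: mult_l2_add_right mult_l2_scaleR mult.commute)
qed

lemma cinner_const_left: "cinner ((\<lambda>_. c) \<odot> f) g = c * cinner f g"
proof (cases f rule: l2_cases, cases g rule: l2_cases)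
  fix u v assume "u \<in> sq_integrable" "f = abs_l2 u" "v \<in> sq_integrable" "g = abs_l2 v"
  then show ?thesis
    by (simp add: cinner_abs_l2 mult_abs_l2 Linf_const sq_integrable_scale mult.assoc)
qed

lemma cinner_diff_left: "cinner (f - g) h = cinner f h - cinner g h"
  using cinner_add_left[of "f - g" g h] by simp

lemma cinner_diff_right: "cinner f (g - h) = cinner f g - cinner f h"
  using cinner_add_right[of f "g - h" h] by simp

lemma cinner_zero_left [simp]: "cinner 0 f = 0"
  using cinner_diff_left[of 0 0 f] by simp

lemma cinner_zero_right [simp]: "cinner f 0 = 0"
  using cinner_diff_right[of f 0 0] by simp

lemma cinner_eq_zero_commute: "cinner f g = 0 \<longleftrightarrow> cinner g f = 0"
  by (subst cinner_commute) simp

lemma cinner_self_eq_zero: "cinner f f = 0 \<Longrightarrow> f = 0"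
  using inner_eq_zero_iff[of f] by (simp add: inner_l2_def)

text \<open>The imaginary part of a complex number is the real part of its product with
  \<open>- \<i>\<close>. Continuity and orthogonality for the real inner product thereby pass to
  \<open>cinner\<close>.\<close>

lemma cinner_eq_inner:
  "cinner f g = complex_of_real (inner f g) + \<i> * complex_of_real (inner ((\<lambda>_. - \<i>) \<odot> f) g)"
  by (simp add: inner_l2_def cinner_const_left complex_eq_iff)

lemma tendsto_cinner_left:
  assumes "X \<longlonglongrightarrow> f"
  shows "(\<lambda>n. cinner (X n) g) \<longlonglongrightarrow> cinner f g"
  unfolding cinner_eq_inner
  by (intro tendsto_intros assms bounded_linear.tendsto[OF bounded_linear_mult_l2] Linf_const)

section \<open>Orthogonal projections onto subspaces of \<open>l2\<close>\<close>

definition csubspace :: "l2 set \<Rightarrow> bool" where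
  "csubspace V \<longleftrightarrow> subspace V \<and> (\<forall>c. \<forall>v\<in>V. (\<lambda>_. c) \<odot> v \<in> V)"

text \<open>Two candidates differ by an element of \<open>V\<close> that is orthogonal to itself.
  Every projection below is computed by exhibiting a candidate and checking its residual.\<close>

lemma proj_eqI:
  assumes V: "subspace V" and p: "p \<in> V" "\<And>v. v \<in> V \<Longrightarrow> cinner (f - p) v = 0"
  shows "proj V f = p"
  unfolding proj_def
proof (rule the_equality)
  show "p \<in> V \<and> (\<forall>v\<in>V. cinner (f - p) v = 0)" using p by blast
  fix q assume q: "q \<in> V \<and> (\<forall>v\<in>V. cinner (f - q) v = 0)"
  have d: "q - p \<in> V" using V p q by (simp add: subspace_diff)
  have "cinner (q - p) (q - p) = cinner (f - p) (q - p) - cinner (f - q) (q - p)"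
    by (simp add: cinner_diff_left)
  also have "\<dots> = 0" using d p q by simp
  finally show "q = p" using cinner_self_eq_zero[of "q - p"] by simp
qed

text \<open>The real projection theorem only annihilates real parts; testing against
  \<open>\<i> v\<close>, which is again in \<open>V\<close>, annihilates the imaginary part.\<close>

lemma closed_csubspace_proj:
  assumes V: "csubspace V" and cl: "closed V"
  shows "proj V f \<in> V" and "v \<in> V \<Longrightarrow> cinner (f - proj V f) v = 0"
proof -
  have sV: "subspace V" using V by (simp add: csubspace_def)
  obtain p where p: "p \<in> V" "\<And>v. v \<in> V \<Longrightarrow> inner (f - p) v = 0"
    using hilbert_projection_exists[OF sV cl] by blast
  have orth: "cinner (f - p) v = 0" if v: "v \<in> V" for v
  proof -
    have "(\<lambda>_. \<i>) \<odot> v \<in> V" using V v by (simp add: csubspace_def)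
    then have "inner ((\<lambda>_. - \<i>) \<odot> (f - p)) v = 0"
      using p(2)[of "(\<lambda>_. \<i>) \<odot> v"] by (simp add: inner_l2_def cinner_mult_left Linf_const)
    then show ?thesis using p(2)[OF v] by (simp add: cinner_eq_inner)
  qed
  have "proj V f = p" using sV p(1) orth by (rule proj_eqI)
  then show "proj V f \<in> V" "v \<in> V \<Longrightarrow> cinner (f - proj V f) v = 0"
    using p(1) orth by auto
qed

text \<open>Linearity is uniqueness of the projection, and the bound 1 is Pythagoras. The projection
  property is taken as a hypothesis so that it may come from closedness, as for \<open>H2\<close>,
  or from a formula, as for \<open>K_space \<theta>\<close>.\<close>

lemma bounded_linear_proj:
  assumes V: "subspace V" and p: "\<And>f. proj V f \<in> V" "\<And>f v. v \<in> V \<Longrightarrow> cinner (f - proj V f) v = 0"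
  shows "bounded_linear (proj V)"
proof (rule bounded_linear_intro[where K = 1])
  fix f g :: l2 and r :: real
  show "proj V (f + g) = proj V f + proj V g"
  proof (rule proj_eqI[OF V])
    show "proj V f + proj V g \<in> V" using V p by (simp add: subspace_add)
    fix v assume "v \<in> V"
    have "f + g - (proj V f + proj V g) = (f - proj V f) + (g - proj V g)" by simp
    then show "cinner (f + g - (proj V f + proj V g)) v = 0"
      using p(2)[OF \<open>v \<in> V\<close>] by (simp only: cinner_add_left add_0)
  qed
  show "proj V (r *\<^sub>R f) = r *\<^sub>R proj V f"
  proof (rule proj_eqI[OF V])
    show "r *\<^sub>R proj V f \<in> V" using V p by (simp add: subspace_scale)
    fix v assume "v \<in> V"
    have "r *\<^sub>R f - r *\<^sub>R proj V f = (\<lambda>_. complex_of_real r) \<odot> (f - proj V f)"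
      by (simp add: mult_l2_const scaleR_diff_right)
    then show "cinner (r *\<^sub>R f - r *\<^sub>R proj V f) v = 0"
      using p(2)[OF \<open>v \<in> V\<close>] by (simp only: cinner_const_left mult_zero_right)
  qed
  have "inner (f - proj V f) (proj V f) = 0"
    unfolding inner_l2_def p(2)[OF p(1)] by simp
  then have "(norm (proj V f))\<^sup>2 + (norm (f - proj V f))\<^sup>2 = (norm f)\<^sup>2"
    using norm_add_Pythagorean[of "proj V f" "f - proj V f"]
    by (simp add: orthogonal_def inner_commute[of "proj V f"])
  then have "(norm (proj V f))\<^sup>2 \<le> (norm f)\<^sup>2"
    using zero_le_power2[of "norm (f - proj V f)"] by linarith
  then show "norm (proj V f) \<le> norm f * 1"
    unfolding mult_1_right by (rule power2_le_imp_le) simp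
qed

section \<open>Fourier coefficients\<close>

text \<open>Passes to the gauge integral on a compact interval, where the fundamental theorem of
  calculus is available; the added endpoint is negligible.\<close>

lemma integral_circle:
  fixes f :: "complex \<Rightarrow> complex"
  assumes "continuous_on UNIV (\<lambda>t. f (cis t))" and [measurable]: "f \<in> borel_measurable borel"
  shows "(\<integral>z. f z \<partial>circle) = integral {0..2 * pi} (\<lambda>t. f (cis t)) / of_real (2 * pi)"
proof -
  have c: "continuous_on A (\<lambda>t. f (cis t))" for A
    by (rule continuous_on_subset[OF assms(1)]) simp
  have dens: "uniform_measure lborel {0..<2 * pi}
      = density lborel (\<lambda>t. ennreal (indicator {0..<2 * pi} t / (2 * pi)))"
    unfolding uniform_measure_def
    by (intro arg_cong[where f = "density lborel"] ext)
       (auto simp: divide_ennreal[symmetric] indicator_def)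
  have "(\<integral>z. f z \<partial>circle) = (\<integral>t. f (cis t) \<partial>uniform_measure lborel {0..<2 * pi})"
    unfolding circle_def by (subst integral_distr) auto
  also have "\<dots> = (\<integral>t. (indicator {0..<2 * pi} t / (2 * pi)) *\<^sub>R f (cis t) \<partial>lborel)"
    unfolding dens by (subst integral_density) auto
  also have "\<dots> = (\<integral>t. (indicator {0..<2 * pi} t *\<^sub>R f (cis t)) / of_real (2 * pi) \<partial>lborel)"
    by (intro Bochner_Integration.integral_cong) (auto simp: scaleR_conv_of_real indicator_def)
  also have "\<dots> = (LINT t:{0..<2 * pi}|lborel. f (cis t)) / of_real (2 * pi)"
    unfolding set_lebesgue_integral_def by (rule integral_divide_zero)
  also have "(LINT t:{0..<2 * pi}|lborel. f (cis t)) = integral {0..<2 * pi} (\<lambda>t. f (cis t))"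
  proof (rule set_borel_integral_eq_integral)
    have "set_integrable lborel {0..2 * pi} (\<lambda>t. f (cis t))"
      by (intro borel_integrable_atLeastAtMost') (rule c)
    then show "set_integrable lborel {0..<2 * pi} (\<lambda>t. f (cis t))"
      by (rule set_integrable_subset) auto
  qed
  also have "\<dots> = integral {0..2 * pi} (\<lambda>t. f (cis t))"
  proof (rule integral_spike_set)
    have "{t \<in> {0..<2 * pi} - {0..2 * pi}. f (cis t) \<noteq> 0} = {}" by auto
    then show "negligible {t \<in> {0..<2 * pi} - {0..2 * pi}. f (cis t) \<noteq> 0}"
      by (simp only: negligible_empty)
    show "negligible {t \<in> {0..2 * pi} - {0..<2 * pi}. f (cis t) \<noteq> 0}"
      by (rule negligible_subset[of "{2 * pi}"]) auto
  qed
  finally show ?thesis .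
qed

lemma powi_measurable [measurable]: "(\<lambda>z :: complex. z powi n) \<in> borel_measurable borel"
  unfolding power_int_def by measurable

text \<open>The antiderivative \<open>cis (n t) / (\<i> n)\<close> takes the same value at both ends
  of the period.\<close>

lemma integral_circle_powi:
  assumes "n \<noteq> 0"
  shows "(\<integral>z. z powi n \<partial>circle) = 0"
proof -
  have "(\<integral>z. z powi n \<partial>circle) = integral {0..2 * pi} (\<lambda>t. cis (of_int n * t)) / of_real (2 * pi)"
    by (subst integral_circle) (auto simp: cis_power_int intro!: continuous_intros)
  moreover have "((\<lambda>t. cis (of_int n * t)) has_integral
      cis (of_int n * (2 * pi)) / (\<i> * of_int n) - cis (of_int n * 0) / (\<i> * of_int n)) {0..2 * pi}"
  proof (rule fundamental_theorem_of_calculus)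
    fix t
    show "((\<lambda>t. cis (of_int n * t) / (\<i> * of_int n)) has_vector_derivative cis (of_int n * t))
        (at t within {0..2 * pi})"
    proof -
      have "((\<lambda>w. exp (\<i> * of_int n * w) / (\<i> * of_int n)) has_field_derivative
          exp (\<i> * of_int n * of_real t)) (at (of_real t))"
        using assms by (auto intro!: derivative_eq_intros)
      from has_vector_derivative_real_field[OF this, of "{0..2 * pi}"] show ?thesis
        by (simp add: cis_conv_exp mult.assoc)
    qed
  qed simp
  moreover have "cis (of_int n * (2 * pi)) = 1"
    using cis_multiple_2pi[of "of_int n"] by (simp add: mult_ac)
  ultimately show ?thesis by (simp add: integral_unique)
qed

lemma AE_circle_powi_norm: "AE z in circle. cmod (z powi n) = 1"
  using AE_circle_norm by eventually_elim (simp add: norm_power_int)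

lemma powi_Linf: "(\<lambda>z. z powi n) \<in> Linf"
proof -
  have "AE z in circle. cmod (z powi n) \<le> 1"
    using AE_circle_powi_norm[of n] by eventually_elim simp
  then show ?thesis by (auto simp: Linf_def)
qed

text \<open>The law of exponents fails at \<open>z = 0\<close> when \<open>m = - n\<close> is
  nonzero, so it can only hold almost everywhere.\<close>

lemma AE_circle_powi_add: "AE z in circle. z powi (m + n) = z powi m * z powi n"
  using AE_circle_norm
proof eventually_elim
  case (elim z)
  then have "z \<noteq> 0" by auto
  then show ?case by (simp add: power_int_add)
qed

lemma AE_circle_cnj_powi: "AE z in circle. cnj (z powi n) = z powi (- n)"
  using AE_circle_norm
proof eventually_elim
  case (elim z)
  then have "cnj z = inverse z"
    using inverse_unique[of z "cnj z"] complex_norm_square[of z] by simp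
  then show ?case by (simp add: power_int_inverse power_int_minus)
qed

section \<open>Functions whose Fourier coefficients all vanish\<close>

lemma integrable_mult_Linf:
  assumes F: "integrable circle F" and a: "a \<in> Linf"
  shows "integrable circle (\<lambda>z. a z * F z :: complex)"
proof -
  obtain C where C: "0 \<le> C" "AE z in circle. cmod (a z) \<le> C" by (rule Linf_bound[OF a])
  show ?thesis
  proof (rule Bochner_Integration.integrable_bound)
    show "integrable circle (\<lambda>z. C * cmod (F z))" using F by simp
    show "(\<lambda>z. a z * F z) \<in> borel_measurable circle"
      using Linf_measurable[OF a] F by measurable
    show "AE z in circle. norm (a z * F z) \<le> norm (C * cmod (F z))"
      using C(2)
    proof eventually_elim
      case (elim z)
      then show ?case using C(1) by (simp add: norm_mult mult_right_mono)
    qed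
  qed
qed

lemma continuous_Linf:
  fixes q :: "complex \<Rightarrow> complex"
  assumes q: "continuous_on UNIV q"
  shows "q \<in> Linf"
proof -
  have [measurable]: "q \<in> borel_measurable borel"
    using q by (rule borel_measurable_continuous_onI)
  have "compact (q ` sphere 0 1)"
    by (intro compact_continuous_image continuous_on_subset[OF q]) auto
  then have "bounded (q ` sphere 0 1)" by (rule compact_imp_bounded)
  then obtain C where C: "\<forall>z\<in>sphere 0 1. cmod (q z) \<le> C"
    by (auto simp: bounded_iff)
  have "AE z in circle. cmod (q z) \<le> C"
    using AE_circle_norm
  proof eventually_elim
    case (elim z)
    then show ?case using C by simp
  qed
  then have "\<exists>C. AE z in circle. cmod (q z) \<le> C" by (rule exI)
  then show ?thesis
    by (simp add: Linf_def)
qed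

lemma continuous_real_Linf:
  fixes q :: "complex \<Rightarrow> real"
  assumes "continuous_on UNIV q"
  shows "(\<lambda>z. complex_of_real (q z)) \<in> Linf"
  by (intro continuous_Linf continuous_on_of_real assms)

text \<open>A real linear form is a combination of \<open>z\<close> and \<open>cnj z\<close>, and on
  the circle \<open>cnj z\<close> is the inverse of \<open>z\<close>; multiplication by it only
  shifts Fourier indices by one in each direction. \<open>F\<close> is generalised because the
  product case applies the hypothesis for \<open>p\<close> to \<open>q F\<close>.\<close>

lemma fourier_coeff_zero_mult_polynomial:
  fixes q :: "complex \<Rightarrow> real" and F :: "complex \<Rightarrow> complex"
  assumes "real_polynomial_function q" and "integrable circle F" and "\<And>n. fourier_coeff F n = 0"
  shows "fourier_coeff (\<lambda>z. q z * F z) n = 0"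
  using assms
proof (induction q arbitrary: F n rule: real_polynomial_function.induct)
  case (linear q)
  \<comment> \<open>Solves \<open>\<alpha> + \<beta> = q 1\<close> and
    \<open>\<i> * (\<alpha> - \<beta>) = q \<i>\<close>, the values of the form on the real
    basis.\<close>
  define \<alpha> \<beta> where "\<alpha> = (q 1 - \<i> * q \<i>) / 2" and "\<beta> = (q 1 + \<i> * q \<i>) / 2"
  have q: "complex_of_real (q z) = \<alpha> * z + \<beta> * cnj z" for z
  proof -
    have "q z = q (Re z *\<^sub>R 1 + Im z *\<^sub>R \<i>)"
      by (intro arg_cong[where f = q]) (simp add: complex_eq_iff)
    also have "\<dots> = Re z * q 1 + Im z * q \<i>"
      using linear(1) by (simp add: linear_simps)
    finally show ?thesis
      by (simp add: \<alpha>_def \<beta>_def complex_eq_iff field_simps)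
  qed
  have i: "integrable circle (\<lambda>z. F z * z powi k)" for k
    using integrable_mult_Linf[OF linear(2) powi_Linf] by (simp add: mult.commute)
  have "fourier_coeff (\<lambda>z. q z * F z) n
      = (\<integral>z. \<alpha> * (F z * z powi (- (n - 1))) + \<beta> * (F z * z powi (- (n + 1))) \<partial>circle)"
    unfolding fourier_coeff_def
  proof (rule integral_cong_AE)
    show "AE z in circle. complex_of_real (q z) * F z * z powi - n
        = \<alpha> * (F z * z powi (- (n - 1))) + \<beta> * (F z * z powi (- (n + 1)))"
      using AE_circle_powi_add[of 1 "-n"] AE_circle_powi_add[of "-1" "-n"] AE_circle_cnj_powi[of 1]
    proof eventually_elim
      case (elim z)
      have e: "- (n - 1) = 1 + - n" "- (n + 1) = - 1 + - n" by simp_all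
      show ?case
        unfolding q e elim(1,2) using elim(3) by (simp add: algebra_simps)
    qed
    show "(\<lambda>z. complex_of_real (q z) * F z * z powi - n) \<in> borel_measurable circle"
      using integrable_mult_Linf[OF i[of "-n"] continuous_real_Linf[of q]] linear(1)
      by (simp add: linear_continuous_on mult.assoc borel_measurable_integrable)
    show "(\<lambda>z. \<alpha> * (F z * z powi (- (n - 1))) + \<beta> * (F z * z powi (- (n + 1)))) \<in> borel_measurable circle"
      by (intro borel_measurable_integrable Bochner_Integration.integrable_add integrable_mult_right i)
  qed
  also have "\<dots> = \<alpha> * fourier_coeff F (n - 1) + \<beta> * fourier_coeff F (n + 1)"
    unfolding fourier_coeff_def
    by (subst Bochner_Integration.integral_add) (intro integrable_mult_right i, intro integrable_mult_right i, simp only: integral_mult_right_zero)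
  finally show ?case using linear(3) by simp
next
  case (const c)
  then show ?case by (simp add: fourier_coeff_def mult.assoc)
next
  case (add p q)
  have "integrable circle (\<lambda>z. complex_of_real (r z) * F z * z powi - n)"
    if r: "real_polynomial_function r" for r
  proof -
    have "continuous_on UNIV r"
      using continuous_real_polymonial_function[OF r] by (simp add: continuous_at_imp_continuous_on)
    from integrable_mult_Linf[OF integrable_mult_Linf[OF add.prems(1) continuous_real_Linf[OF this]]
        powi_Linf[of "-n"]]
    show ?thesis by (simp only: mult_ac)
  qed
  from this[OF add.hyps(1)] this[OF add.hyps(2)] show ?case
    using add.IH(1)[OF add.prems, of n] add.IH(2)[OF add.prems, of n]
    by (simp add: fourier_coeff_def distrib_right)
next
  case (mult p q)
  have "integrable circle (\<lambda>z. complex_of_real (q z) * F z)"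
    using integrable_mult_Linf[OF mult.prems(1) continuous_real_Linf[of q]]
      continuous_real_polymonial_function[OF mult.hyps(2)]
    by (simp add: continuous_at_imp_continuous_on)
  from mult.IH(1)[OF this mult.IH(2)[OF mult.prems]] show ?case
    by (simp add: mult.assoc)
qed

text \<open>By Stone-Weierstrass on the unit circle, \<open>q\<close> is uniformly close to a
  polynomial \<open>p\<close> in the real coordinates. The integral of \<open>p F\<close> is its
  coefficient of index 0, hence zero, and the error is at most \<open>e\<close> times the L1 norm of
  \<open>F\<close>.\<close>

lemma integral_zero_if_fourier_coeff_zero:
  fixes q :: "complex \<Rightarrow> real" and F :: "complex \<Rightarrow> complex"
  assumes F: "integrable circle F" "\<And>n. fourier_coeff F n = 0" and q: "continuous_on UNIV q"
  shows "(\<integral>z. q z * F z \<partial>circle) = 0"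
proof -
  have "cmod (\<integral>z. q z * F z \<partial>circle) \<le> e * (\<integral>z. cmod (F z) \<partial>circle)" if e: "0 < e" for e
  proof -
    obtain p where p: "real_polynomial_function p" "\<And>z. z \<in> sphere 0 1 \<Longrightarrow> \<bar>q z - p z\<bar> < e"
      by (rule Stone_Weierstrass_real_polynomial_function
          [OF compact_sphere[of 0 1] continuous_on_subset[OF q subset_UNIV] e]) blast
    have cp: "continuous_on UNIV p"
      using continuous_real_polymonial_function[OF p(1)] by (simp add: continuous_at_imp_continuous_on)
    have "(\<integral>z. p z * F z \<partial>circle) = 0"
      using fourier_coeff_zero_mult_polynomial[OF p(1) F, of 0] by (simp add: fourier_coeff_def)
    moreover note ip = integrable_mult_Linf[OF F(1) continuous_real_Linf[OF cp]]
      and iq = integrable_mult_Linf[OF F(1) continuous_real_Linf[OF q]]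
    ultimately have "(\<integral>z. q z * F z \<partial>circle) = (\<integral>z. q z * F z - p z * F z \<partial>circle)"
      by simp
    also have "cmod \<dots> \<le> (\<integral>z. cmod (q z * F z - p z * F z) \<partial>circle)"
      by (rule integral_norm_bound)
    also have "\<dots> \<le> (\<integral>z. e * cmod (F z) \<partial>circle)"
    proof (rule integral_mono_AE)
      show "AE z in circle. cmod (q z * F z - p z * F z) \<le> e * cmod (F z)"
        using AE_circle_norm
      proof eventually_elim
        case (elim z)
        have "cmod (q z * F z - p z * F z) = \<bar>q z - p z\<bar> * cmod (F z)"
          by (simp only: left_diff_distrib[symmetric] of_real_diff[symmetric] norm_mult norm_of_real)
        also have "\<dots> \<le> e * cmod (F z)"
          using p(2)[of z] elim by (intro mult_right_mono) auto
        finally show ?case .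
      qed
    qed (use F ip iq in auto)
    finally show ?thesis by simp
  qed
  note bound = this
  define I where "I = (\<integral>z. cmod (F z) \<partial>circle)"
  have I: "0 \<le> I" by (simp add: I_def)
  have "cmod (\<integral>z. q z * F z \<partial>circle) \<le> 0"
  proof (rule field_le_epsilon)
    fix e :: real assume e: "0 < e"
    \<comment> \<open>Dividing by \<open>I + 1\<close> instead of \<open>I\<close> covers the case
      \<open>I = 0\<close>.\<close>
    have "cmod (\<integral>z. q z * F z \<partial>circle) \<le> e / (I + 1) * I"
      unfolding I_def by (rule bound) (use I e in \<open>simp add: I_def[symmetric]\<close>)
    also have "\<dots> \<le> e" using I e by (simp add: field_simps)
    finally show "cmod (\<integral>z. q z * F z \<partial>circle) \<le> 0 + e" by simp
  qed
  then show ?thesis by simp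
qed

text \<open>Continuous functions first, then indicators of closed sets as their limits, then all Borel sets.\<close>

lemma AE_zero_if_fourier_coeff_zero:
  assumes F: "integrable circle F" "\<And>n. fourier_coeff F n = 0"
  shows "AE z in circle. F z = 0"
proof (rule circle.density_zero[OF F(1)])
  fix A assume "A \<in> sets circle"
  then have A: "A \<in> sigma_sets UNIV (Collect closed)"
    by (simp add: borel_eq_closed)
  have borel: "B \<in> sigma_sets UNIV (Collect closed) \<Longrightarrow> B \<in> sets circle" for B :: "complex set"
    by (simp add: borel_eq_closed)
  have int: "set_integrable circle B F" if "B \<in> sets circle" for B
    unfolding set_integrable_def by (intro integrable_mult_indicator that F)
  have closed_case: "set_lebesgue_integral circle A F = 0" if A: "closed A" for A
  \<comment> \<open>\<open>infdist\<close> to the empty set is 0 by convention, which would make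
    every cutoff \<open>q k\<close> below constantly 1.\<close>
  proof (cases "A = {}")
    case True
    then show ?thesis by (simp add: set_lebesgue_integral_def)
  next
    case False
    \<comment> \<open>Equal to 1 on \<open>A\<close> and to 0 at distance at least
      \<open>1 / k\<close> (for positive \<open>k\<close>). As \<open>A\<close> is closed, points
      outside have positive distance, so the limit is the indicator of \<open>A\<close>.\<close>
    define q where "q k z = max 0 (1 - real k * infdist z A)" for k z
    have "(\<lambda>k. \<integral>z. q k z *\<^sub>R F z \<partial>circle) \<longlonglongrightarrow> (\<integral>z. indicator A z *\<^sub>R F z \<partial>circle)"
    proof (rule integral_dominated_convergence)
      have q: "continuous_on UNIV (q k)" for k
        unfolding q_def by (intro continuous_intros)
      then have "q k \<in> borel_measurable borel" for k
        by (rule borel_measurable_continuous_onI)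
      then have [measurable]: "q k \<in> borel_measurable circle" for k
        by simp
      show "(\<lambda>z. q k z *\<^sub>R F z) \<in> borel_measurable circle" for k
        using F(1) by measurable
      show "(\<lambda>z. indicator A z *\<^sub>R F z) \<in> borel_measurable circle"
        using F(1) A by (intro borel_measurable_scaleR borel_measurable_indicator) auto
      show "integrable circle (\<lambda>z. cmod (F z))" using F by simp
      show "AE z in circle. (\<lambda>k. q k z *\<^sub>R F z) \<longlonglongrightarrow> indicator A z *\<^sub>R F z"
      proof (rule AE_I2)
        fix z
        have "(\<lambda>k. q k z) \<longlonglongrightarrow> indicator A z"
        proof (cases "z \<in> A")
          case True
          then show ?thesis by (simp add: q_def)
        next
          case zA: False
          then have d: "0 < infdist z A"
            using A False by (simp add: infdist_pos_not_in_closed)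
          obtain N :: nat where N: "1 / infdist z A < N" using reals_Archimedean2 by blast
          have "q k z = 0" if "k \<ge> N" for k
          proof -
            have "real N \<le> real k" using that by simp
            then have "1 / infdist z A \<le> k" using N by linarith
            then show ?thesis using d by (simp add: q_def field_simps)
          qed
          then have "\<forall>\<^sub>F k in sequentially. q k z = 0"
            by (rule eventually_sequentiallyI)
          then show ?thesis using zA by (simp add: tendsto_eventually)
        qed
        then show "(\<lambda>k. q k z *\<^sub>R F z) \<longlonglongrightarrow> indicator A z *\<^sub>R F z"
          by (intro tendsto_intros)
      qed
      show "AE z in circle. norm (q k z *\<^sub>R F z) \<le> cmod (F z)" for k
        by (rule AE_I2) (auto simp: q_def infdist_nonneg mult_left_le_one_le)
    qed
    moreover have "(\<integral>z. q k z *\<^sub>R F z \<partial>circle) = 0" for k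
      unfolding scaleR_conv_of_real
      by (intro integral_zero_if_fourier_coeff_zero F) (auto simp: q_def intro!: continuous_intros)
    ultimately show ?thesis
      by (simp add: set_lebesgue_integral_def LIMSEQ_const_iff)
  qed
  \<comment> \<open>Dynkin's argument: vanishing of the set integral passes to complements, since
    the whole plane is closed, and to countable disjoint unions.\<close>
  have "Int_stable (Collect closed :: complex set set)"
    by (auto simp: Int_stable_def)
  moreover have "Collect closed \<subseteq> Pow (UNIV :: complex set)" by simp
  ultimately show "set_lebesgue_integral circle A F = 0"
    using A
  proof (induction rule: sigma_sets_induct_disjoint)
    case (basic A)
    then show ?case by (simp add: closed_case)
  next
    case empty
    show ?case by (simp add: set_lebesgue_integral_def)
  next
    case (compl A)
    have "set_lebesgue_integral circle (A \<union> (UNIV - A)) F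
        = set_lebesgue_integral circle A F + set_lebesgue_integral circle (UNIV - A) F"
      using borel[OF compl(1)] by (intro set_integral_Un int) auto
    moreover have "set_lebesgue_integral circle UNIV F = 0" by (simp add: closed_case)
    ultimately show ?case using compl by simp
  next
    case (union A)
    have s: "A i \<in> sets circle" for i using union(2) borel by blast
    have "set_lebesgue_integral circle (\<Union>i. A i) F = (\<Sum>i. set_lebesgue_integral circle (A i) F)"
      using union(1) s by (intro lebesgue_integral_countable_add int) (auto simp: disjoint_family_on_def)
    then show ?case using union(3) by simp
  qed
qed

section \<open>The Hardy space and the model spaces\<close>

definition fourier_mode :: "int \<Rightarrow> l2" where
  "fourier_mode n = abs_l2 (\<lambda>z. z powi n)"

lemma fourier_coeff_eq_cinner:
  assumes "f \<in> sq_integrable"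
  shows "fourier_coeff f n = cinner (abs_l2 f) (fourier_mode n)"
proof -
  have [measurable]: "f \<in> borel_measurable borel"
    using sq_integrable_measurable[OF assms] by simp
  have "(\<integral>z. f z * z powi (- n) \<partial>circle) = (\<integral>z. f z * cnj (z powi n) \<partial>circle)"
  proof (rule integral_cong_AE)
    show "AE z in circle. f z * z powi (- n) = f z * cnj (z powi n)"
      using AE_circle_cnj_powi[of n] by eventually_elim (simp only:)
  qed simp_all
  then show ?thesis
    using assms by (simp only: fourier_coeff_def fourier_mode_def cinner_abs_l2 Linf_sq_integrable[OF powi_Linf])
qed

text \<open>Replaces chosen representatives by continuous functionals; the subspace laws and
  closedness can be read off from this form.\<close>

lemma H2_iff: "f \<in> H2 \<longleftrightarrow> (\<forall>n<0. cinner f (fourier_mode n) = 0)"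
  by (simp add: H2_def fourier_coeff_eq_cinner rep_l2_sq_integrable)

text \<open>A multiplier has a Laurent matrix in the Fourier basis. For \<open>a\<close> in
  \<open>Hinf\<close> its entries vanish above the diagonal, and \<open>a = 1\<close> gives
  orthogonality of the modes.\<close>

lemma cinner_mult_fourier_mode:
  assumes "a \<in> Linf"
  shows "cinner (a \<odot> fourier_mode m) (fourier_mode n) = fourier_coeff a (n - m)"
proof -
  have [measurable]: "a \<in> borel_measurable borel"
    using Linf_measurable[OF assms] by simp
  have sq: "(\<lambda>z. a z * z powi m) \<in> sq_integrable"
    by (intro Linf_sq_integrable Linf_mult assms powi_Linf)
  have "cinner (a \<odot> fourier_mode m) (fourier_mode n) = fourier_coeff (\<lambda>z. a z * z powi m) n"
    unfolding fourier_coeff_eq_cinner[OF sq]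
    by (simp add: fourier_mode_def mult_abs_l2 assms Linf_sq_integrable[OF powi_Linf])
  also have "\<dots> = fourier_coeff a (n - m)"
    unfolding fourier_coeff_def
  proof (rule integral_cong_AE)
    show "AE z in circle. a z * z powi m * z powi - n = a z * z powi - (n - m)"
      using AE_circle_powi_add[of m "-n"] by eventually_elim (simp add: mult.assoc)
  qed simp_all
  finally show ?thesis .
qed

lemma fourier_mode_in_H2:
  assumes "0 \<le> m"
  shows "fourier_mode m \<in> H2"
proof -
  have "cinner (fourier_mode m) (fourier_mode n) = 0" if "n < 0" for n
    using cinner_mult_fourier_mode[OF Linf_const[of 1], of m n] assms that
    by (simp add: mult_l2_one fourier_coeff_def integral_circle_powi)
  then show ?thesis by (simp add: H2_iff)
qed

lemma csubspace_H2: "csubspace H2"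
  unfolding csubspace_def subspace_def
  by (auto simp: H2_iff cinner_add_left cinner_const_left mult_l2_const[symmetric])

lemma subspace_H2: "subspace H2"
  using csubspace_H2 by (simp add: csubspace_def)

lemma closed_H2: "closed H2"
  unfolding closed_sequential_limits
proof (intro allI impI, elim conjE)
  fix X f assume X: "\<forall>n. X n \<in> H2" "X \<longlonglongrightarrow> f"
  have "cinner f (fourier_mode m) = 0" if "m < 0" for m
    using tendsto_cinner_left[OF X(2), of "fourier_mode m"] X(1) that
    by (simp add: H2_iff LIMSEQ_const_iff)
  then show "f \<in> H2" by (simp add: H2_iff)
qed

lemma proj_H2_in: "proj H2 f \<in> H2"
  by (rule closed_csubspace_proj(1)[OF csubspace_H2 closed_H2])

lemma cinner_diff_proj_H2: "h \<in> H2 \<Longrightarrow> cinner (f - proj H2 f) h = 0"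
  by (rule closed_csubspace_proj(2)[OF csubspace_H2 closed_H2])

lemma bounded_linear_proj_H2: "bounded_linear (proj H2)"
  by (intro bounded_linear_proj subspace_H2 proj_H2_in cinner_diff_proj_H2)

lemma proj_H2_ident: "f \<in> H2 \<Longrightarrow> proj H2 f = f"
  by (rule proj_eqI[OF subspace_H2]) auto

lemma cinner_proj_H2_left: "h \<in> H2 \<Longrightarrow> cinner (proj H2 f) h = cinner f h"
  using cinner_diff_proj_H2[of h f] by (simp add: cinner_diff_left)

lemma proj_H2_eq_0_iff: "proj H2 f = 0 \<longleftrightarrow> (\<forall>h\<in>H2. cinner f h = 0)"
proof
  assume "proj H2 f = 0"
  then show "\<forall>h\<in>H2. cinner f h = 0"
    using cinner_proj_H2_left[of _ f] by auto
next
  assume "\<forall>h\<in>H2. cinner f h = 0"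
  then show "proj H2 f = 0"
    by (intro proj_eqI subspace_H2) (auto simp: subspace_0[OF subspace_H2])
qed

lemma fourier_mode_complete:
  assumes "\<And>n. cinner f (fourier_mode n) = 0"
  shows "f = 0"
proof (cases f rule: l2_cases)
  fix u assume u: "u \<in> sq_integrable" "f = abs_l2 u"
  have "AE z in circle. u z = 0"
    using u assms
    by (intro AE_zero_if_fourier_coeff_zero sq_integrable_imp_integrable)
       (simp_all add: fourier_coeff_eq_cinner)
  then show ?thesis
    unfolding u(2) zero_l2_def map_fun_def id_def
    by (intro abs_l2_eqI u sq_integrable_0)
qed

text \<open>
  A function whose nonnegative Fourier coefficients vanish is orthogonal to \<open>H2\<close>: its
  projection to \<open>H2\<close> has no nonzero Fourier coefficient at all.
\<close>

lemma cinner_H2_eq_0: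
  assumes h: "\<And>n. 0 \<le> n \<Longrightarrow> cinner h (fourier_mode n) = 0" and f: "f \<in> H2"
  shows "cinner h f = 0"
proof -
  have "cinner (proj H2 h) (fourier_mode n) = 0" for n
  proof (cases "n < 0")
    case True
    then show ?thesis using proj_H2_in[of h] by (simp add: H2_iff)
  next
    case False
    then show ?thesis by (simp add: cinner_proj_H2_left fourier_mode_in_H2 h)
  qed
  then have "proj H2 h = 0" by (rule fourier_mode_complete)
  then show ?thesis using f by (simp add: proj_H2_eq_0_iff)
qed

text \<open>By duality: for \<open>n < 0\<close> the product of \<open>cnj a\<close> with the mode
  \<open>n\<close> has no nonnegative Fourier coefficients, hence is orthogonal to all of
  \<open>H2\<close> and not merely to its modes.\<close>

lemma Hinf_mult_H2:
  assumes a: "a \<in> Hinf" and f: "f \<in> H2"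
  shows "a \<odot> f \<in> H2"
  unfolding H2_iff
proof (intro allI impI)
  fix n :: int assume n: "n < 0"
  have L: "a \<in> Linf" using a by (simp add: Hinf_def)
  have "cinner ((\<lambda>z. cnj (a z)) \<odot> fourier_mode n) (fourier_mode m) = 0" if "0 \<le> m" for m
  proof -
    have "cinner (a \<odot> fourier_mode m) (fourier_mode n) = 0"
      using a n that by (simp add: cinner_mult_fourier_mode[OF L] Hinf_def)
    then show ?thesis
      unfolding cinner_mult_left[OF Linf_cnj[OF L]] complex_cnj_cnj
      by (subst cinner_eq_zero_commute)
  qed
  then have "cinner ((\<lambda>z. cnj (a z)) \<odot> fourier_mode n) f = 0"
    using f by (rule cinner_H2_eq_0)
  then show "cinner (a \<odot> f) (fourier_mode n) = 0"
    unfolding cinner_mult_left[OF L] by (subst cinner_eq_zero_commute)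
qed

lemma unimodular_cnj_mult_cancel:
  assumes "a \<in> Linf" "unimodular a"
  shows "(\<lambda>z. cnj (a z)) \<odot> a \<odot> f = f" and "a \<odot> (\<lambda>z. cnj (a z)) \<odot> f = f"
proof -
  have "AE z in circle. cnj (a z) * a z = 1"
    using assms(2) unfolding unimodular_def
  proof eventually_elim
    case (elim z)
    then show ?case using complex_norm_square[of "a z"] by (simp add: mult.commute)
  qed
  then have "(\<lambda>z. cnj (a z) * a z) \<odot> f = f"
    using mult_l2_cong[OF Linf_mult[OF Linf_cnj[OF assms(1)] assms(1)] Linf_const[of 1]]
    by (simp add: mult_l2_one)
  then show "(\<lambda>z. cnj (a z)) \<odot> a \<odot> f = f" "a \<odot> (\<lambda>z. cnj (a z)) \<odot> f = f"
    using assms by (simp_all add: mult_l2_mult Linf_cnj mult.commute)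
qed

lemma mult_l2_diff_right: "a \<odot> (f - g) = a \<odot> f - a \<odot> g"
  using mult_l2_add_right[of a "f - g" g] by simp

lemma mult_l2_zero_right [simp]: "a \<odot> 0 = 0"
  using mult_l2_diff_right[of a 0 0] by simp

section \<open>The model space of an inner function\<close>

locale inner_function =
  fixes \<theta> :: "complex \<Rightarrow> complex"
  assumes inner: "is_inner_function \<theta>"
begin

definition c\<theta> where "c\<theta> = (\<lambda>z. cnj (\<theta> z))"

lemma \<theta>_Linf: "\<theta> \<in> Linf" and \<theta>_Hinf: "\<theta> \<in> Hinf" and \<theta>_unimodular: "unimodular \<theta>"
  using inner by (auto simp: is_inner_function_def Hinf_def)

lemma c\<theta>_Linf: "c\<theta> \<in> Linf"
  unfolding c\<theta>_def by (rule Linf_cnj[OF \<theta>_Linf])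

lemma c\<theta>_\<theta>: "c\<theta> \<odot> \<theta> \<odot> f = f"
  unfolding c\<theta>_def by (rule unimodular_cnj_mult_cancel[OF \<theta>_Linf \<theta>_unimodular])

lemma \<theta>_mult_H2: "f \<in> H2 \<Longrightarrow> \<theta> \<odot> f \<in> H2"
  by (rule Hinf_mult_H2[OF \<theta>_Hinf])

lemma cinner_c\<theta>_left: "cinner (c\<theta> \<odot> f) g = cinner f (\<theta> \<odot> g)"
  using cinner_mult_left[OF c\<theta>_Linf] by (simp add: c\<theta>_def)

text \<open>The model space as the kernel of the Toeplitz operator with symbol
  \<open>c\<theta>\<close>, the operator in the first two rows of the system.\<close>

lemma K_space_iff: "f \<in> K_space \<theta> \<longleftrightarrow> f \<in> H2 \<and> proj H2 (c\<theta> \<odot> f) = 0"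
  by (simp add: K_space_def proj_H2_eq_0_iff cinner_c\<theta>_left)

lemma subspace_K: "subspace (K_space \<theta>)"
  using csubspace_H2 unfolding csubspace_def subspace_def K_space_def
  by (auto simp: cinner_add_left cinner_const_left mult_l2_const[symmetric])

text \<open>Multiplication by \<open>\<theta>\<close> is unitary on \<open>l2\<close>, so projecting
  \<open>c\<theta> \<odot> f\<close> to \<open>H2\<close> and multiplying back is the projection
  onto \<open>\<theta>\<close> times \<open>H2\<close>. Subtracting it from the projection onto
  \<open>H2\<close> leaves the complement, and the formula supplies existence as well.\<close>

lemma
  shows K_proj_eq: "proj (K_space \<theta>) f = proj H2 f - \<theta> \<odot> proj H2 (c\<theta> \<odot> f)"
    and K_proj_in: "proj (K_space \<theta>) f \<in> K_space \<theta>"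
    and cinner_diff_K_proj: "k \<in> K_space \<theta> \<Longrightarrow> cinner (f - proj (K_space \<theta>) f) k = 0"
proof -
  define p where "p = proj H2 f - \<theta> \<odot> proj H2 (c\<theta> \<odot> f)"
  have "p \<in> H2"
    unfolding p_def by (intro subspace_diff subspace_H2 proj_H2_in \<theta>_mult_H2)
  moreover have "cinner p (\<theta> \<odot> h) = 0" if h: "h \<in> H2" for h
  proof -
    have "cinner (\<theta> \<odot> proj H2 (c\<theta> \<odot> f)) (\<theta> \<odot> h) = cinner (proj H2 (c\<theta> \<odot> f)) h"
      by (simp add: cinner_mult_left[OF \<theta>_Linf] c\<theta>_\<theta> flip: c\<theta>_def)
    then show ?thesis
      by (simp add: p_def cinner_diff_left cinner_proj_H2_left h \<theta>_mult_H2 cinner_c\<theta>_left)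
  qed
  ultimately have pK: "p \<in> K_space \<theta>" by (simp add: K_space_def)
  have orth: "cinner (f - p) k = 0" if k: "k \<in> K_space \<theta>" for k
  proof -
    have "cinner (\<theta> \<odot> proj H2 (c\<theta> \<odot> f)) k = 0"
      using k proj_H2_in by (subst cinner_eq_zero_commute) (simp add: K_space_def)
    moreover have "cinner (f - proj H2 f) k = 0"
      using k by (intro cinner_diff_proj_H2) (simp add: K_space_def)
    moreover have "f - p = (f - proj H2 f) + \<theta> \<odot> proj H2 (c\<theta> \<odot> f)"
      by (simp add: p_def)
    ultimately show ?thesis by (simp only: cinner_add_left add_0)
  qed
  have eq: "proj (K_space \<theta>) f = p"
    using subspace_K pK orth by (rule proj_eqI)
  show "proj (K_space \<theta>) f = proj H2 f - \<theta> \<odot> proj H2 (c\<theta> \<odot> f)"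
    unfolding eq p_def ..
  show "proj (K_space \<theta>) f \<in> K_space \<theta>" unfolding eq by (rule pK)
  show "k \<in> K_space \<theta> \<Longrightarrow> cinner (f - proj (K_space \<theta>) f) k = 0"
    unfolding eq by (rule orth)
qed

lemma bounded_linear_K_proj: "bounded_linear (proj (K_space \<theta>))"
  by (intro bounded_linear_proj subspace_K K_proj_in cinner_diff_K_proj)

lemma K_proj_ident: "k \<in> K_space \<theta> \<Longrightarrow> proj (K_space \<theta>) k = k"
  by (rule proj_eqI[OF subspace_K]) auto

lemma K_proj_eq_0: "(\<And>k. k \<in> K_space \<theta> \<Longrightarrow> cinner f k = 0) \<Longrightarrow> proj (K_space \<theta>) f = 0"
  by (rule proj_eqI[OF subspace_K]) (auto simp: subspace_0[OF subspace_K])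

text \<open>\<open>c\<theta>\<close> preserves the orthogonal complement of \<open>H2\<close>; this
  is the adjoint form of the invariance of \<open>H2\<close> under \<open>\<theta>\<close>.\<close>

lemma proj_H2_c\<theta>_proj_H2: "proj H2 (c\<theta> \<odot> proj H2 f) = proj H2 (c\<theta> \<odot> f)"
proof -
  have "proj H2 (c\<theta> \<odot> (proj H2 f - f)) = 0"
    by (simp add: proj_H2_eq_0_iff cinner_c\<theta>_left cinner_diff_left cinner_proj_H2_left \<theta>_mult_H2)
  then show ?thesis
    by (simp add: mult_l2_diff_right linear_diff[OF bounded_linear.linear[OF bounded_linear_proj_H2]])
qed

lemma K_proj_proj_H2: "proj (K_space \<theta>) (proj H2 f) = proj (K_space \<theta>) f"
  by (simp add: K_proj_eq proj_H2_c\<theta>_proj_H2 proj_H2_ident proj_H2_in)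

lemma K_proj_\<theta>: "h \<in> H2 \<Longrightarrow> proj (K_space \<theta>) (\<theta> \<odot> h) = 0"
  by (simp add: K_proj_eq c\<theta>_\<theta> proj_H2_ident \<theta>_mult_H2)

end

section \<open>Transfer of invertibility\<close>

text \<open>A bounded inverse is the same as a lower bound for \<open>T\<close>, which can be
  estimated without \<open>inv_into\<close>. The constant is made nonnegative so that inequalities
  may be multiplied by it.\<close>

lemma invertible_on_iff:
  "invertible_on V T \<longleftrightarrow> bij_betw T V V \<and> (\<exists>C\<ge>0. \<forall>x\<in>V. norm x \<le> C * norm (T x))"
proof (cases "bij_betw T V V")
  case True
  have "(\<exists>C. \<forall>y\<in>V. norm (inv_into V T y) \<le> C * norm y)
      \<longleftrightarrow> (\<exists>C. \<forall>x\<in>V. norm x \<le> C * norm (T x))"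
  proof (intro arg_cong[where f = Ex] ext iffI ballI)
    fix C x assume "\<forall>y\<in>V. norm (inv_into V T y) \<le> C * norm y" "x \<in> V"
    then show "norm x \<le> C * norm (T x)"
      using bij_betw_apply[OF True, of x] bij_betw_inv_into_left[OF True, of x] by force
  next
    fix C y assume "\<forall>x\<in>V. norm x \<le> C * norm (T x)" "y \<in> V"
    then show "norm (inv_into V T y) \<le> C * norm y"
      using bij_betw_apply[OF bij_betw_inv_into[OF True], of y] bij_betw_inv_into_right[OF True, of y]
      by force
  qed
  also have "\<dots> \<longleftrightarrow> (\<exists>C\<ge>0. \<forall>x\<in>V. norm x \<le> C * norm (T x))"
  proof
    assume "\<exists>C. \<forall>x\<in>V. norm x \<le> C * norm (T x)"
    then obtain C where C: "\<forall>x\<in>V. norm x \<le> C * norm (T x)" by blast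
    have "norm x \<le> \<bar>C\<bar> * norm (T x)" if "x \<in> V" for x
      using order_trans[OF C[rule_format, OF that] mult_right_mono[OF abs_ge_self norm_ge_zero]] .
    then show "\<exists>C\<ge>0. \<forall>x\<in>V. norm x \<le> C * norm (T x)" by (intro exI[of _ "\<bar>C\<bar>"]) simp
  qed blast
  finally show ?thesis using True by (simp add: invertible_on_def)
qed (simp add: invertible_on_def)

text \<open>By \<open>TJ\<close>, \<open>RG\<close>, \<open>GR\<close> and \<open>JR\<close>,
  \<open>V\<close> is parametrised by the pairs \<open>(y, m)\<close> with
  \<open>T m = \<Phi> y\<close>. If \<open>T\<close> is bijective, each \<open>y\<close> determines
  its \<open>m\<close> and thus its \<open>x\<close>. Conversely, \<open>T m = h\<close> becomes
  \<open>G x = U h\<close>, because \<open>U\<close> is a right inverse of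
  \<open>\<Phi>\<close>.\<close>

lemma
  fixes G :: "'a::real_normed_vector \<Rightarrow> 'a" and T :: "'b::real_normed_vector \<Rightarrow> 'b"
    and J :: "'a \<Rightarrow> 'b" and U :: "'b \<Rightarrow> 'a" and \<Phi> :: "'a \<Rightarrow> 'b" and R :: "'a \<times> 'b \<Rightarrow> 'a"
  assumes lin: "bounded_linear J" "bounded_linear U" "bounded_linear \<Phi>" "bounded_linear R"
    and G_maps: "\<And>x. x \<in> V \<Longrightarrow> G x \<in> V" and T_maps: "\<And>m. m \<in> W \<Longrightarrow> T m \<in> W"
    and J_maps: "\<And>x. x \<in> V \<Longrightarrow> J x \<in> W" and U_maps: "\<And>m. m \<in> W \<Longrightarrow> U m \<in> V"
    and \<Phi>_maps: "\<And>y. y \<in> V \<Longrightarrow> \<Phi> y \<in> W"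
    and R_maps: "\<And>y m. y \<in> V \<Longrightarrow> m \<in> W \<Longrightarrow> R (y, m) \<in> V"
    and TJ: "\<And>x. x \<in> V \<Longrightarrow> T (J x) = \<Phi> (G x)"
    and RG: "\<And>x. x \<in> V \<Longrightarrow> R (G x, J x) = x"
    and GR: "\<And>y m. y \<in> V \<Longrightarrow> m \<in> W \<Longrightarrow> T m = \<Phi> y \<Longrightarrow> G (R (y, m)) = y"
    and JR: "\<And>y m. y \<in> V \<Longrightarrow> m \<in> W \<Longrightarrow> J (R (y, m)) = m"
    and \<Phi>U: "\<And>m. m \<in> W \<Longrightarrow> \<Phi> (U m) = m"
  shows invertible_on_transfer: "invertible_on W T \<longleftrightarrow> invertible_on V G"
    and inv_into_transfer: "invertible_on W T \<Longrightarrow> h \<in> W \<Longrightarrow> inv_into W T h = J (inv_into V G (U h))"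
proof -
  obtain CJ where CJ: "0 < CJ" "\<And>x. norm (J x) \<le> norm x * CJ"
    using bounded_linear.pos_bounded[OF lin(1)] by blast
  obtain CU where CU: "0 < CU" "\<And>x. norm (U x) \<le> norm x * CU"
    using bounded_linear.pos_bounded[OF lin(2)] by blast
  obtain C\<Phi> where C\<Phi>: "0 < C\<Phi>" "\<And>x. norm (\<Phi> x) \<le> norm x * C\<Phi>"
    using bounded_linear.pos_bounded[OF lin(3)] by blast
  obtain CR where CR: "0 < CR" "\<And>x. norm (R x) \<le> norm x * CR"
    using bounded_linear.pos_bounded[OF lin(4)] by blast
  show eq: "invertible_on W T \<longleftrightarrow> invertible_on V G"
  proof
    assume "invertible_on W T"
    then obtain C0 where bij: "bij_betw T W W" and C0: "0 \<le> C0" "\<And>m. m \<in> W \<Longrightarrow> norm m \<le> C0 * norm (T m)"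
      unfolding invertible_on_iff by blast
    show "invertible_on V G"
      unfolding invertible_on_iff
    proof (intro conjI exI ballI)
      show "bij_betw G V V"
        unfolding bij_betw_def
      proof (intro conjI inj_onI equalityI subsetI)
        fix x x' assume x: "x \<in> V" "x' \<in> V" and eq: "G x = G x'"
        have "T (J x) = T (J x')" using x eq by (simp add: TJ)
        then have "J x = J x'"
          by (rule inj_onD[OF bij_betw_imp_inj_on[OF bij]]) (intro J_maps x)+
        then have "R (G x, J x) = R (G x', J x')" by (simp only: eq)
        then show "x = x'" by (simp only: RG x)
      next
        fix y assume y: "y \<in> V"
        have "\<Phi> y \<in> T ` W" unfolding bij_betw_imp_surj_on[OF bij] by (rule \<Phi>_maps[OF y])
        then obtain m where "m \<in> W" "T m = \<Phi> y" by (metis imageE)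
        then show "y \<in> G ` V" using y by (intro image_eqI[of y G "R (y, m)"] GR[symmetric] R_maps)
      qed (use G_maps in auto)
      \<comment> \<open>From \<open>x = R (G x, J x)\<close>: the summand 1 accounts for
        \<open>G x\<close>, and \<open>C0 * C\<Phi>\<close> for \<open>J x\<close>, which is bounded
        through \<open>T (J x) = \<Phi> (G x)\<close>.\<close>
      show "0 \<le> (1 + C0 * C\<Phi>) * CR" using C\<Phi>(1) CR(1) C0 by simp
      fix x assume x: "x \<in> V"
      have "norm (J x) \<le> C0 * norm (\<Phi> (G x))" using C0(2)[OF J_maps[OF x]] x by (simp add: TJ)
      also have "\<dots> \<le> C0 * (norm (G x) * C\<Phi>)" by (intro mult_left_mono C\<Phi> C0)
      finally have J: "norm (J x) \<le> C0 * C\<Phi> * norm (G x)" by (simp add: mult_ac)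
      have "norm x = norm (R (G x, J x))" using x by (simp add: RG)
      also have "\<dots> \<le> norm (G x, J x) * CR" by (rule CR)
      also have "\<dots> \<le> (norm (G x) + norm (J x)) * CR"
        using CR(1) by (intro mult_right_mono norm_Pair_le) auto
      also have "\<dots> \<le> (norm (G x) + C0 * C\<Phi> * norm (G x)) * CR"
        using CR(1) J by (intro mult_right_mono add_left_mono) auto
      finally show "norm x \<le> (1 + C0 * C\<Phi>) * CR * norm (G x)"
        by (simp add: algebra_simps)
    qed
  next
    assume "invertible_on V G"
    then obtain C0 where bij: "bij_betw G V V" and C0: "0 \<le> C0" "\<And>x. x \<in> V \<Longrightarrow> norm x \<le> C0 * norm (G x)"
      unfolding invertible_on_iff by blast
    \<comment> \<open>The pair \<open>(U (T m), m)\<close> meets the constraint of \<open>GR\<close>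
      since \<open>\<Phi> (U (T m)) = T m\<close>. Thus every \<open>m\<close> lifts to a point of
      \<open>V\<close>, where injectivity and the lower bound of \<open>G\<close> apply.\<close>
    have E: "R (U (T m), m) \<in> V" "G (R (U (T m), m)) = U (T m)" "J (R (U (T m), m)) = m" if "m \<in> W" for m
      using that by (simp_all add: R_maps U_maps T_maps GR JR \<Phi>U)
    show "invertible_on W T"
      unfolding invertible_on_iff
    proof (intro conjI exI ballI)
      show "bij_betw T W W"
        unfolding bij_betw_def
      proof (intro conjI inj_onI equalityI subsetI)
        fix m m' assume m: "m \<in> W" "m' \<in> W" and eq: "T m = T m'"
        have "G (R (U (T m), m)) = G (R (U (T m'), m'))" 
          by (rule trans[OF E(2)[OF m(1)] trans[OF arg_cong[OF eq, of U] E(2)[OF m(2), symmetric]]])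
        then have "R (U (T m), m) = R (U (T m'), m')"
          by (rule inj_onD[OF bij_betw_imp_inj_on[OF bij]]) (intro E(1) m)+
        then have "J (R (U (T m), m)) = J (R (U (T m'), m'))" by (rule arg_cong)
        then show "m = m'" by (simp only: E(3) m)
      next
        fix h assume h: "h \<in> W"
        have "U h \<in> G ` V" unfolding bij_betw_imp_surj_on[OF bij] by (rule U_maps[OF h])
        then obtain x where "x \<in> V" "G x = U h" by (metis imageE)
        then show "h \<in> T ` W"
          using h by (intro image_eqI[of h T "J x"]) (simp_all add: TJ \<Phi>U J_maps)
      qed (use T_maps in auto)
      show "0 \<le> C0 * CU * CJ" using CU(1) CJ(1) C0 by simp
      fix m assume m: "m \<in> W"
      have "norm (R (U (T m), m)) \<le> C0 * norm (U (T m))"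
        using C0(2)[OF E(1)[OF m]] E(2)[OF m] by simp
      also have "\<dots> \<le> C0 * (norm (T m) * CU)" by (intro mult_left_mono CU C0)
      finally have *: "norm (R (U (T m), m)) \<le> C0 * (norm (T m) * CU)" .
      have "norm m = norm (J (R (U (T m), m)))" using E(3)[OF m] by simp
      also have "\<dots> \<le> norm (R (U (T m), m)) * CJ" by (rule CJ)
      also have "\<dots> \<le> C0 * (norm (T m) * CU) * CJ"
        using CJ(1) by (intro mult_right_mono *) auto
      finally show "norm m \<le> C0 * CU * CJ * norm (T m)" by (simp add: mult_ac)
    qed
  qed
  assume inv: "invertible_on W T" and h: "h \<in> W"
  have bij: "bij_betw G V V" "bij_betw T W W" using inv eq by (auto simp: invertible_on_def)
  define x where "x = inv_into V G (U h)"
  have x: "x \<in> V" "G x = U h"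
    using bij_betw_apply[OF bij_betw_inv_into[OF bij(1)] U_maps[OF h]]
      bij_betw_inv_into_right[OF bij(1) U_maps[OF h]] by (simp_all add: x_def)
  then have "T (J x) = h" using h by (simp add: TJ \<Phi>U)
  then have "inv_into W T h = J x"
    using bij_betw_inv_into_left[OF bij(2) J_maps[OF x(1)]] by simp
  then show "inv_into W T h = J (inv_into V G (U h))" unfolding x_def .
qed

lemma bounded_linear_vec:
  fixes f :: "'a::real_normed_vector \<Rightarrow> 'b::real_normed_vector ^ 'n"
  assumes "\<And>i. bounded_linear (\<lambda>x. f x $ i)"
  shows "bounded_linear f"
proof -
  have "\<exists>K. \<forall>x. norm (f x $ i) \<le> norm x * K" for i
    using bounded_linear.bounded[OF assms[of i]] .
  then obtain K where K: "\<And>i x. norm (f x $ i) \<le> norm x * K i" by metis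
  show ?thesis
  proof (rule bounded_linear_intro[where K = "\<Sum>i\<in>UNIV. K i"])
    fix x y :: 'a and r :: real
    show "f (x + y) = f x + f y"
      by (simp add: vec_eq_iff linear_add[OF bounded_linear.linear[OF assms]])
    show "f (r *\<^sub>R x) = r *\<^sub>R f x"
      by (simp add: vec_eq_iff linear_scale[OF bounded_linear.linear[OF assms]])
    have "norm (f x) \<le> (\<Sum>i\<in>UNIV. norm (f x $ i))"
      unfolding norm_vec_def by (rule L2_set_le_sum) simp
    also have "\<dots> \<le> (\<Sum>i\<in>UNIV. norm x * K i)" by (intro sum_mono K)
    finally show "norm (f x) \<le> norm x * (\<Sum>i\<in>UNIV. K i)" by (simp add: sum_distrib_left)
  qed
qed

lemma vector_4:
  "(vector [w, x, y, z] :: 'a::zero ^ 4) $ 1 = w"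
  "(vector [w, x, y, z] :: 'a::zero ^ 4) $ 2 = x"
  "(vector [w, x, y, z] :: 'a::zero ^ 4) $ 3 = y"
  "(vector [w, x, y, z] :: 'a::zero ^ 4) $ 4 = z"
  unfolding vector_def by simp_all

lemma bounded_linear_vector_4:
  fixes a b c d :: "'a::real_normed_vector \<Rightarrow> 'b::real_normed_vector"
  assumes "bounded_linear a" "bounded_linear b" "bounded_linear c" "bounded_linear d"
  shows "bounded_linear (\<lambda>x. vector [a x, b x, c x, d x] :: 'b ^ 4)"
proof (rule bounded_linear_vec)
  have "\<forall>i :: 4. bounded_linear (\<lambda>x. (vector [a x, b x, c x, d x] :: 'b ^ 4) $ i)"
    unfolding forall_4 using assms by (simp add: vector_4)
  then show "bounded_linear (\<lambda>x. (vector [a x, b x, c x, d x] :: 'b ^ 4) $ i)" for i by blast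
qed

section \<open>The compression to a sum of two model spaces\<close>

locale paired_model_spaces = inner_function +
  fixes \<phi> \<psi> g :: "complex \<Rightarrow> complex"
  assumes \<phi>: "\<phi> \<in> Linf" "unimodular \<phi>" and \<psi>: "\<psi> \<in> Linf" "unimodular \<psi>"
    and orthogonal: "\<And>k l. k \<in> K_space \<theta> \<Longrightarrow> l \<in> K_space \<theta> \<Longrightarrow> cinner (\<phi> \<odot> k) (\<psi> \<odot> l) = 0"
    and g: "g \<in> Linf"
begin

abbreviation P where "P \<equiv> proj H2"
abbreviation Q where "Q \<equiv> proj (K_space \<theta>)"

definition "c\<phi> = (\<lambda>z. cnj (\<phi> z))"
definition "c\<psi> = (\<lambda>z. cnj (\<psi> z))"
text \<open>With \<open>b\<close>, the off-diagonal part of the lower left block of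
  \<open>G_symbol\<close>; it couples the two summands of \<open>M\<close>.\<close>

definition "a = (\<lambda>z. g z * cnj (\<phi> z) * \<psi> z)"
definition "b = (\<lambda>z. g z * \<phi> z * cnj (\<psi> z))"

lemma Linf: "c\<phi> \<in> Linf" "c\<psi> \<in> Linf" "a \<in> Linf" "b \<in> Linf"
  unfolding c\<phi>_def c\<psi>_def a_def b_def by (intro Linf_mult Linf_cnj \<phi> \<psi> g)+

lemma c\<phi>_\<phi>: "c\<phi> \<odot> \<phi> \<odot> f = f" and c\<psi>_\<psi>: "c\<psi> \<odot> \<psi> \<odot> f = f"
  unfolding c\<phi>_def c\<psi>_def using \<phi> \<psi> by (simp_all add: unimodular_cnj_mult_cancel)

lemma c\<phi>_g_\<phi>: "c\<phi> \<odot> g \<odot> \<phi> \<odot> f = g \<odot> f" and c\<psi>_g_\<psi>: "c\<psi> \<odot> g \<odot> \<psi> \<odot> f = g \<odot> f"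
proof -
  have "c\<phi> \<odot> g \<odot> \<phi> \<odot> f = g \<odot> c\<phi> \<odot> \<phi> \<odot> f" "c\<psi> \<odot> g \<odot> \<psi> \<odot> f = g \<odot> c\<psi> \<odot> \<psi> \<odot> f"
    using Linf \<phi> \<psi> g by (simp_all add: mult_l2_mult Linf_mult mult_ac)
  then show "c\<phi> \<odot> g \<odot> \<phi> \<odot> f = g \<odot> f" "c\<psi> \<odot> g \<odot> \<psi> \<odot> f = g \<odot> f"
    by (simp_all add: c\<phi>_\<phi> c\<psi>_\<psi>)
qed

lemma c\<phi>_g_\<psi>: "c\<phi> \<odot> g \<odot> \<psi> \<odot> f = a \<odot> f" and c\<psi>_g_\<phi>: "c\<psi> \<odot> g \<odot> \<phi> \<odot> f = b \<odot> f"
  using Linf \<phi> \<psi> g by (simp_all add: mult_l2_mult Linf_mult a_def b_def c\<phi>_def c\<psi>_def mult_ac)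

lemmas mult_simps = mult_l2_add_right mult_l2_diff_right

lemma Q_add: "Q (f + h) = Q f + Q h" and Q_diff: "Q (f - h) = Q f - Q h"
  and P_add: "P (f + h) = P f + P h" and P_diff: "P (f - h) = P f - P h"
  using bounded_linear.linear[OF bounded_linear_K_proj] bounded_linear.linear[OF bounded_linear_proj_H2]
  by (simp_all add: linear_add linear_diff)

lemma cinner_c\<phi>_left: "cinner (c\<phi> \<odot> f) h = cinner f (\<phi> \<odot> h)"
  and cinner_c\<psi>_left: "cinner (c\<psi> \<odot> f) h = cinner f (\<psi> \<odot> h)"
  using Linf by (simp_all add: cinner_mult_left) (simp_all add: c\<phi>_def c\<psi>_def)

text \<open>Orthogonality of the summands in operator form; it makes \<open>k\<close> and
  \<open>l\<close> recoverable from \<open>join k l\<close>.\<close>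

lemma Q_c\<phi>_\<psi>: "k \<in> K_space \<theta> \<Longrightarrow> Q (c\<phi> \<odot> \<psi> \<odot> k) = 0"
  by (rule K_proj_eq_0) (simp add: cinner_c\<phi>_left cinner_eq_zero_commute[of "\<psi> \<odot> k"] orthogonal)

lemma Q_c\<psi>_\<phi>: "k \<in> K_space \<theta> \<Longrightarrow> Q (c\<psi> \<odot> \<phi> \<odot> k) = 0"
  by (rule K_proj_eq_0) (simp add: cinner_c\<psi>_left orthogonal)

section \<open>The space \<open>M\<close>, its coordinates and its projection\<close>

abbreviation M where "M \<equiv> M_space \<theta> \<phi> \<psi>"

definition "join k l = \<phi> \<odot> k + \<psi> \<odot> l"

lemma join_in_M: "k \<in> K_space \<theta> \<Longrightarrow> l \<in> K_space \<theta> \<Longrightarrow> join k l \<in> M"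
  by (auto simp: M_space_def join_def)

lemma M_cases:
  assumes "m \<in> M"
  obtains k l where "k \<in> K_space \<theta>" "l \<in> K_space \<theta>" "m = join k l"
  using assms by (auto simp: M_space_def join_def)

lemma Q_c\<phi>_join: "k \<in> K_space \<theta> \<Longrightarrow> l \<in> K_space \<theta> \<Longrightarrow> Q (c\<phi> \<odot> join k l) = k"
  and Q_c\<psi>_join: "k \<in> K_space \<theta> \<Longrightarrow> l \<in> K_space \<theta> \<Longrightarrow> Q (c\<psi> \<odot> join k l) = l"
  by (simp_all add: join_def mult_simps Q_add c\<phi>_\<phi> c\<psi>_\<psi> Q_c\<phi>_\<psi> Q_c\<psi>_\<phi> K_proj_ident)

lemma join_Q: "m \<in> M \<Longrightarrow> join (Q (c\<phi> \<odot> m)) (Q (c\<psi> \<odot> m)) = m"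
  by (erule M_cases) (simp add: Q_c\<phi>_join Q_c\<psi>_join)

lemma subspace_M: "subspace M"
  unfolding subspace_def
proof (intro conjI ballI allI)
  have "join 0 0 \<in> M" by (intro join_in_M subspace_0 subspace_K)
  then show "0 \<in> M" by (simp add: join_def)
next
  fix x y assume "x \<in> M" "y \<in> M"
  then obtain k l k' l' where "k \<in> K_space \<theta>" "l \<in> K_space \<theta>" "x = join k l"
    "k' \<in> K_space \<theta>" "l' \<in> K_space \<theta>" "y = join k' l'"
    by (elim M_cases)
  moreover from this have "x + y = join (k + k') (l + l')"
    by (simp add: join_def mult_simps)
  ultimately show "x + y \<in> M" by (simp add: join_in_M subspace_add subspace_K)
next
  fix r :: real and x assume "x \<in> M"
  then obtain k l where "k \<in> K_space \<theta>" "l \<in> K_space \<theta>" "x = join k l" by (elim M_cases)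
  moreover from this have "r *\<^sub>R x = join (r *\<^sub>R k) (r *\<^sub>R l)"
    by (simp add: join_def mult_l2_scaleR scaleR_add_right)
  ultimately show "r *\<^sub>R x \<in> M" by (simp add: join_in_M subspace_scale subspace_K)
qed

text \<open>Conjugating \<open>Q\<close> by a unimodular multiplier gives the projection onto one
  summand, and orthogonality allows the two to be added. This also settles the existence of the
  projection onto \<open>M\<close>.\<close>

lemma proj_M: "proj M f = join (Q (c\<phi> \<odot> f)) (Q (c\<psi> \<odot> f))"
proof (rule proj_eqI[OF subspace_M])
  show "join (Q (c\<phi> \<odot> f)) (Q (c\<psi> \<odot> f)) \<in> M" by (intro join_in_M K_proj_in)
  fix v assume "v \<in> M"
  then obtain k l where v: "k \<in> K_space \<theta>" "l \<in> K_space \<theta>" "v = join k l" by (elim M_cases)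
  let ?d = "f - join (Q (c\<phi> \<odot> f)) (Q (c\<psi> \<odot> f))"
  have "Q (c\<phi> \<odot> ?d) = 0" "Q (c\<psi> \<odot> ?d) = 0"
    by (simp_all add: mult_l2_diff_right Q_diff Q_c\<phi>_join Q_c\<psi>_join K_proj_in)
  then have "cinner (c\<phi> \<odot> ?d) k = 0" "cinner (c\<psi> \<odot> ?d) l = 0"
    using cinner_diff_K_proj[OF v(1), of "c\<phi> \<odot> ?d"] cinner_diff_K_proj[OF v(2), of "c\<psi> \<odot> ?d"]
    by simp_all
  then show "cinner ?d v = 0"
    unfolding v(3) cinner_c\<phi>_left cinner_c\<psi>_left by (simp add: join_def cinner_add_right)
qed

section \<open>The two operators and the maps that link them\<close>

abbreviation T where "T \<equiv> compression M g"
abbreviation G where "G \<equiv> toeplitz (G_symbol \<theta> \<phi> \<psi> g)"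

text \<open>In the coordinates \<open>(k, l)\<close>, \<open>T\<close> is the block truncated
  Toeplitz operator whose symbol is the lower left block of \<open>G_symbol\<close>.\<close>

lemma T_join: "T (join k l) = join (Q (g \<odot> k + a \<odot> l)) (Q (b \<odot> k + g \<odot> l))"
  unfolding compression_def proj_M
  by (simp add: join_def mult_simps c\<phi>_g_\<phi> c\<phi>_g_\<psi> c\<psi>_g_\<psi> c\<psi>_g_\<phi>)

lemma G_nth:
  "G x $ 1 = P (c\<theta> \<odot> x $ 1)"
  "G x $ 2 = P (c\<theta> \<odot> x $ 2)"
  "G x $ 3 = P (g \<odot> x $ 1 + a \<odot> x $ 2 + \<theta> \<odot> x $ 3)"
  "G x $ 4 = P (b \<odot> x $ 1 + g \<odot> x $ 2 + \<theta> \<odot> x $ 4)"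
  by (simp_all add: toeplitz_def G_symbol_def sum_4 vector_4 mult_l2_zero_left c\<theta>_def a_def b_def)

definition J :: "l2 ^ 4 \<Rightarrow> l2" where
  "J x = join (Q (x $ 1)) (Q (x $ 2))"

text \<open>The right-hand side left after inserting \<open>x_j = \<theta> y_j + k_j\<close> into
  the last two rows and applying \<open>Q\<close>, which removes the terms with \<open>x_3\<close>
  and \<open>x_4\<close>.\<close>

definition \<Phi> :: "l2 ^ 4 \<Rightarrow> l2" where
  "\<Phi> y = join (Q (y $ 3 - (g \<odot> \<theta> \<odot> y $ 1 + a \<odot> \<theta> \<odot> y $ 2)))
    (Q (y $ 4 - (b \<odot> \<theta> \<odot> y $ 1 + g \<odot> \<theta> \<odot> y $ 2)))"

text \<open>\<open>R (y, m)\<close> is the only candidate for a solution \<open>x\<close> of \<open>G x = y\<close> with \<open>J x = m\<close>.\<close>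

definition R1 :: "(l2 ^ 4) \<times> l2 \<Rightarrow> l2" where
  "R1 = (\<lambda>(y, m). \<theta> \<odot> y $ 1 + Q (c\<phi> \<odot> m))"

definition R2 :: "(l2 ^ 4) \<times> l2 \<Rightarrow> l2" where
  "R2 = (\<lambda>(y, m). \<theta> \<odot> y $ 2 + Q (c\<psi> \<odot> m))"

text \<open>The last two entries arise by multiplying rows three and four by
  \<open>c\<theta>\<close> and projecting to \<open>H2\<close>, which isolates \<open>x_3\<close>
  and \<open>x_4\<close>.\<close>

definition R :: "(l2 ^ 4) \<times> l2 \<Rightarrow> l2 ^ 4" where
  "R p = vector [R1 p, R2 p,
    P (c\<theta> \<odot> (fst p $ 3 - (g \<odot> R1 p + a \<odot> R2 p))),
    P (c\<theta> \<odot> (fst p $ 4 - (b \<odot> R1 p + g \<odot> R2 p)))]"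

lemma R_nth:
  "R p $ 1 = R1 p" "R p $ 2 = R2 p"
  "R p $ 3 = P (c\<theta> \<odot> (fst p $ 3 - (g \<odot> R1 p + a \<odot> R2 p)))"
  "R p $ 4 = P (c\<theta> \<odot> (fst p $ 4 - (b \<odot> R1 p + g \<odot> R2 p)))"
  by (simp_all add: R_def vector_4)

abbreviation U where "U \<equiv> U0 \<theta> \<phi> \<psi>"

lemma U_nth: "U m $ 1 = 0" "U m $ 2 = 0" "U m $ 3 = Q (c\<phi> \<odot> m)" "U m $ 4 = Q (c\<psi> \<odot> m)"
  by (simp_all add: U0_def vector_4 c\<phi>_def c\<psi>_def)

lemmas bl_compose = bounded_linear_compose[OF bounded_linear_K_proj]
  bounded_linear_compose[OF bounded_linear_proj_H2]
  bounded_linear_compose[OF bounded_linear_mult_l2[OF \<theta>_Linf]]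
  bounded_linear_compose[OF bounded_linear_mult_l2[OF c\<theta>_Linf]]
  bounded_linear_compose[OF bounded_linear_mult_l2[OF \<phi>(1)]]
  bounded_linear_compose[OF bounded_linear_mult_l2[OF \<psi>(1)]]
  bounded_linear_compose[OF bounded_linear_mult_l2[OF g]]
  Linf[THEN bounded_linear_mult_l2, THEN bounded_linear_compose]
  bounded_linear_compose[OF bounded_linear_vec_nth]
  bounded_linear_add bounded_linear_sub bounded_linear_vec_nth bounded_linear_ident
  bounded_linear_fst bounded_linear_snd bounded_linear_zero

lemma bounded_linear_J: "bounded_linear J"
  unfolding J_def join_def by (intro bl_compose)

lemma bounded_linear_\<Phi>: "bounded_linear \<Phi>"
  unfolding \<Phi>_def join_def by (intro bl_compose)

lemma bounded_linear_U: "bounded_linear U"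
  unfolding U0_def c\<phi>_def[symmetric] c\<psi>_def[symmetric]
  by (intro bounded_linear_vector_4 bl_compose)

lemma bounded_linear_R: "bounded_linear R"
proof -
  have "bounded_linear R1" "bounded_linear R2"
    unfolding R1_def R2_def split_beta by (intro bl_compose)+
  then show ?thesis
    unfolding R_def by (intro bounded_linear_vector_4 bl_compose)
qed

section \<open>The identities between the operators and the linking maps\<close>

lemma H2_vec_iff: "(x :: l2 ^ 4) \<in> H2_vec \<longleftrightarrow> x $ 1 \<in> H2 \<and> x $ 2 \<in> H2 \<and> x $ 3 \<in> H2 \<and> x $ 4 \<in> H2"
  by (simp add: H2_vec_def forall_4)

lemma K_imp_H2: "k \<in> K_space \<theta> \<Longrightarrow> k \<in> H2"
  by (simp add: K_space_iff)

lemma Q_H2: "x \<in> H2 \<Longrightarrow> Q x = x - \<theta> \<odot> P (c\<theta> \<odot> x)"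
  by (simp add: K_proj_eq proj_H2_ident)

text \<open>Apply \<open>Q\<close> to the last two rows: \<open>Q\<close> absorbs \<open>P\<close>,
  it annihilates \<open>\<theta> \<odot> x $ 3\<close> and \<open>\<theta> \<odot> x $ 4\<close>,
  and \<open>Q_H2\<close> splits the first two entries.\<close>

lemma T_J:
  assumes "x \<in> H2_vec"
  shows "T (J x) = \<Phi> (G x)"
proof -
  have x: "x $ 1 \<in> H2" "x $ 2 \<in> H2" "x $ 3 \<in> H2" "x $ 4 \<in> H2"
    using assms by (simp_all add: H2_vec_iff)
  show ?thesis
    unfolding J_def T_join \<Phi>_def G_nth Q_diff K_proj_proj_H2
    by (simp add: Q_H2[OF x(1)] Q_H2[OF x(2)] mult_simps Q_add Q_diff K_proj_\<theta> x algebra_simps)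
qed

text \<open>The first two entries are recovered by \<open>Q_H2\<close>. In the others
  \<open>P\<close> may be dropped under \<open>P (c\<theta> \<odot> _)\<close>; the contributions of
  \<open>x $ 1\<close> and \<open>x $ 2\<close> then cancel.\<close>

lemma R_G:
  assumes "x \<in> H2_vec"
  shows "R (G x, J x) = x"
proof -
  have x: "x $ 1 \<in> H2" "x $ 2 \<in> H2" "x $ 3 \<in> H2" "x $ 4 \<in> H2"
    using assms by (simp_all add: H2_vec_iff)
  have R12: "R1 (G x, J x) = x $ 1" "R2 (G x, J x) = x $ 2"
    unfolding R1_def R2_def J_def
    by (simp_all add: Q_c\<phi>_join Q_c\<psi>_join K_proj_in G_nth) (simp_all add: Q_H2 x)
  show ?thesis
    unfolding vec_eq_iff forall_4 R_nth R12
    by (simp add: G_nth mult_simps P_diff P_add proj_H2_c\<theta>_proj_H2 c\<theta>_\<theta> proj_H2_ident x)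
qed

text \<open>\<open>R1\<close> and \<open>R2\<close> are already sorted along the splitting of
  \<open>H2\<close> into its \<open>\<theta>\<close> multiples and the model space;
  \<open>P (c\<theta> \<odot> _)\<close> reads off the first part and \<open>Q\<close> the
  second.\<close>

lemma R12_Q:
  assumes "y \<in> H2_vec"
  shows "P (c\<theta> \<odot> R1 (y, m)) = y $ 1" "P (c\<theta> \<odot> R2 (y, m)) = y $ 2"
    "Q (R1 (y, m)) = Q (c\<phi> \<odot> m)" "Q (R2 (y, m)) = Q (c\<psi> \<odot> m)"
    "R1 (y, m) \<in> H2" "R2 (y, m) \<in> H2"
proof -
  have K0: "P (c\<theta> \<odot> Q f) = 0" for f
    using K_proj_in[of f] by (simp add: K_space_iff)
  have y: "y $ 1 \<in> H2" "y $ 2 \<in> H2" using assms by (simp_all add: H2_vec_iff)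
  then show "P (c\<theta> \<odot> R1 (y, m)) = y $ 1" "P (c\<theta> \<odot> R2 (y, m)) = y $ 2"
    "Q (R1 (y, m)) = Q (c\<phi> \<odot> m)" "Q (R2 (y, m)) = Q (c\<psi> \<odot> m)"
    by (simp_all add: R1_def R2_def mult_simps P_add Q_add K0 c\<theta>_\<theta> proj_H2_ident K_proj_\<theta>
        K_proj_ident K_proj_in)
  show "R1 (y, m) \<in> H2" "R2 (y, m) \<in> H2"
    using y by (simp_all add: R1_def R2_def subspace_add[OF subspace_H2] \<theta>_mult_H2 K_imp_H2 K_proj_in)
qed

lemma J_R:
  assumes "y \<in> H2_vec" "m \<in> M"
  shows "J (R (y, m)) = m"
  by (simp add: J_def R_nth R12_Q[OF assms(1)] join_Q[OF assms(2)])

lemma G_R: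
  assumes y: "y \<in> H2_vec" and m: "m \<in> M" and eq: "T m = \<Phi> y"
  shows "G (R (y, m)) = y"
proof -
  define k l where "k = Q (c\<phi> \<odot> m)" and "l = Q (c\<psi> \<odot> m)"
  have kl: "m = join k l" using join_Q[OF m] by (simp add: k_def l_def)
  have H2: "y $ 3 \<in> H2" "y $ 4 \<in> H2" using y by (simp_all add: H2_vec_iff)
  have R12: "R1 (y, m) = \<theta> \<odot> y $ 1 + k" "R2 (y, m) = \<theta> \<odot> y $ 2 + l"
    by (simp_all add: R1_def R2_def k_def l_def)
  let ?u = "g \<odot> R1 (y, m) + a \<odot> R2 (y, m)" and ?v = "b \<odot> R1 (y, m) + g \<odot> R2 (y, m)"
  \<comment> \<open>\<open>Q\<close> after \<open>c\<phi>\<close> extracts the first coordinate of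
    the equation \<open>T m = \<Phi> y\<close> in \<open>M\<close>.\<close>
  have "Q (g \<odot> k + a \<odot> l) = Q (y $ 3 - (g \<odot> \<theta> \<odot> y $ 1 + a \<odot> \<theta> \<odot> y $ 2))"
    using arg_cong[OF eq, of "\<lambda>f. Q (c\<phi> \<odot> f)"]
    unfolding kl T_join \<Phi>_def by (simp add: Q_c\<phi>_join K_proj_in)
  then have "Q (y $ 3 - ?u) = 0"
    unfolding R12 by (simp add: mult_simps Q_diff Q_add algebra_simps)
  \<comment> \<open>Vanishing of \<open>Q\<close> means that the \<open>H2\<close> part of
    \<open>y $ 3 - ?u\<close> is a multiple of \<open>\<theta>\<close>; the cofactor is the third
    entry of \<open>R (y, m)\<close>, so row three holds.\<close>
  then have "P (y $ 3) - P ?u = \<theta> \<odot> P (c\<theta> \<odot> (y $ 3 - ?u))"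
    unfolding K_proj_eq[of "y $ 3 - ?u"] by (simp add: P_diff)
  then have u: "P (y $ 3) = P ?u + \<theta> \<odot> P (c\<theta> \<odot> (y $ 3 - ?u))"
    unfolding diff_eq_eq by (simp only: add.commute)
  have "Q (b \<odot> k + g \<odot> l) = Q (y $ 4 - (b \<odot> \<theta> \<odot> y $ 1 + g \<odot> \<theta> \<odot> y $ 2))"
    using arg_cong[OF eq, of "\<lambda>f. Q (c\<psi> \<odot> f)"]
    unfolding kl T_join \<Phi>_def by (simp add: Q_c\<psi>_join K_proj_in)
  then have "Q (y $ 4 - ?v) = 0"
    unfolding R12 by (simp add: mult_simps Q_diff Q_add algebra_simps)
  then have "P (y $ 4) - P ?v = \<theta> \<odot> P (c\<theta> \<odot> (y $ 4 - ?v))"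
    unfolding K_proj_eq[of "y $ 4 - ?v"] by (simp add: P_diff)
  then have v: "P (y $ 4) = P ?v + \<theta> \<odot> P (c\<theta> \<odot> (y $ 4 - ?v))"
    unfolding diff_eq_eq by (simp only: add.commute)
  have \<theta>P: "P (\<theta> \<odot> P f) = \<theta> \<odot> P f" for f
    by (intro proj_H2_ident \<theta>_mult_H2 proj_H2_in)
  show ?thesis
    unfolding vec_eq_iff forall_4 G_nth R_nth fst_conv P_add[of ?u] P_add[of ?v] \<theta>P
      u[symmetric] v[symmetric] R12_Q[OF y]
    by (simp add: proj_H2_ident H2)
qed

text \<open>\<open>U0\<close> leaves the first two slots empty, so the correction terms in
  \<open>\<Phi>\<close> vanish and only the coordinates of \<open>m\<close> remain.\<close>

lemma \<Phi>_U:
  assumes "m \<in> M"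
  shows "\<Phi> (U m) = m"
  using join_Q[OF assms] by (simp add: \<Phi>_def U_nth K_proj_ident K_proj_in)

lemma G_maps: "G x \<in> H2_vec"
  by (simp add: H2_vec_iff G_nth proj_H2_in)

lemma U_maps: "U m \<in> H2_vec"
  by (simp add: H2_vec_iff U_nth K_imp_H2 K_proj_in subspace_0[OF subspace_H2])

lemma R_maps: "y \<in> H2_vec \<Longrightarrow> R (y, m) \<in> H2_vec"
  by (simp add: H2_vec_iff[of "R (y, m)"] R_nth R12_Q proj_H2_in)

lemma J_maps: "J x \<in> M" and \<Phi>_maps: "\<Phi> y \<in> M" and T_maps: "T m \<in> M"
  by (simp_all add: J_def \<Phi>_def compression_def proj_M join_in_M K_proj_in)

lemmas transfer_hyps = bounded_linear_J bounded_linear_U bounded_linear_\<Phi> bounded_linear_R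
  G_maps T_maps J_maps U_maps \<Phi>_maps R_maps T_J R_G G_R J_R \<Phi>_U

lemma invertible_iff: "invertible_on M T \<longleftrightarrow> invertible_on H2_vec G"
  by (rule invertible_on_transfer[OF transfer_hyps])

lemma inv_into_T:
  assumes inv: "invertible_on M T" and h: "h \<in> M"
  shows "inv_into M T h = \<phi> \<odot> (inv_into H2_vec G (U h) $ 1) + \<psi> \<odot> (inv_into H2_vec G (U h) $ 2)"
proof -
  define x where "x = inv_into H2_vec G (U h)"
  have bij: "bij_betw G H2_vec H2_vec"
    using inv unfolding invertible_iff by (simp add: invertible_on_def)
  have x: "x \<in> H2_vec" "G x = U h"
    using bij_betw_apply[OF bij_betw_inv_into[OF bij] U_maps] bij_betw_inv_into_right[OF bij U_maps]
    by (simp_all add: x_def)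
  \<comment> \<open>The empty first slots of \<open>U h\<close> force \<open>x $ 1\<close> and
    \<open>x $ 2\<close> into the model space, so the \<open>Q\<close> in \<open>J\<close> has no
    effect and the formula contains the bare components.\<close>
  then have "P (c\<theta> \<odot> x $ 1) = 0" "P (c\<theta> \<odot> x $ 2) = 0"
    using G_nth(1,2)[of x] by (simp_all add: U_nth)
  then have Q: "Q (x $ 1) = x $ 1" "Q (x $ 2) = x $ 2"
    using x(1) by (simp_all add: H2_vec_iff Q_H2)
  have "inv_into M T h = J x"
    unfolding x_def by (rule inv_into_transfer[OF transfer_hyps inv h])
  then show ?thesis
    unfolding x_def[symmetric] J_def join_def Q .
qed

end

theorem corollary4p6:
  fixes \<theta> \<phi> \<psi> g :: "complex \<Rightarrow> complex"
  assumes "is_inner_function \<theta>"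
    and "\<phi> \<in> Linf" and "unimodular \<phi>"
    and "\<psi> \<in> Linf" and "unimodular \<psi>"
    and "\<forall>k\<in>K_space \<theta>. \<forall>l\<in>K_space \<theta>. cinner (\<phi> \<odot> k) (\<psi> \<odot> l) = 0"
    and "\<not> (\<exists>c. AE z in circle. \<phi> z * cnj (\<psi> z) = c * \<theta> z)"
    and "\<not> (\<exists>c. AE z in circle. cnj (\<phi> z) * \<psi> z = c * \<theta> z)"
    and "g \<in> Linf"
  defines "M \<equiv> M_space \<theta> \<phi> \<psi>"
    and "T \<equiv> compression (M_space \<theta> \<phi> \<psi>) g"
    and "TG \<equiv> toeplitz (G_symbol \<theta> \<phi> \<psi> g)"
  shows "(invertible_on M T \<longleftrightarrow> invertible_on H2_vec TG) \<and>
    (invertible_on M T \<longrightarrow>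
      (\<forall>h\<in>M. inv_into M T h =
         \<phi> \<odot> (inv_into H2_vec TG (U0 \<theta> \<phi> \<psi> h) $ 1) +
         \<psi> \<odot> (inv_into H2_vec TG (U0 \<theta> \<phi> \<psi> h) $ 2)))"
proof -
  interpret paired_model_spaces \<theta> \<phi> \<psi> g
    by unfold_locales (use assms(1-6,9) in \<open>blast+\<close>)
  show ?thesis
    unfolding M_def T_def TG_def by (intro conjI impI ballI invertible_iff inv_into_T)
qed

end
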